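(* Let $k$ be a positive integer and let $G$ be a simple graph that is $(2k+1)$-weakly $(8k+4)$-connected, i.e. for any two disjoint vertex sets $A,B$ with $A\neq\emptyset$ and $A\cup B\subsetneq V(G)$, $d_{G-B}(A)\ge 8k+4-(2k+1)|B|$. Then $G$ has a smooth orientation which is $(2k+1)$-arc-strong and such that for each vertex $v$, the resulting directed graph $G-v$ is $k$-arc-strong.
   Context: Graphs are finite and loopless. $d_{G-B}(A)$ is the number of edges of $G-B$ with exactly one end in $A$. An orientation is smooth if $|d^+(v)-d^-(v)|\le 1$ for every vertex $v$. A directed graph $D$ is $t$-arc-strong if $d^-_D(X)\ge t$ for every nonempty proper subset $X\subsetneq V(D)$, where $d^-_D(X)$ is the number of arcs entering $X$. *)

theory Defs
  imports "Graph_Theory.Graph_Theory"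
begin

text \<open>A finite simple graph is a \<^const>\<open>pair_graph\<close>: an edge \<open>{u, v}\<close> is represented by the two
  opposite arcs \<open>(u, v)\<close> and \<open>(v, u)\<close>. Edges are counted as unordered pairs, so that each edge is
  counted once.\<close>

definition uedges :: "('a, 'b) pre_digraph \<Rightarrow> 'a set set" where
  "uedges G = (\<lambda>e. {tail G e, head G e}) ` arcs G"

definition cut_degree :: "('a, 'b) pre_digraph \<Rightarrow> 'a set \<Rightarrow> nat" where
  "cut_degree G A = card {e \<in> uedges G. card (e \<inter> A) = 1}"

text \<open>The lower bound on the cut degree is an integer; it is negative when \<open>B\<close> is large.\<close>

definition weakly_connected :: "nat \<Rightarrow> nat \<Rightarrow> ('a, 'b) pre_digraph \<Rightarrow> bool" where
  "weakly_connected p q G \<longleftrightarrow>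
    (\<forall>A B. A \<inter> B = {} \<and> A \<noteq> {} \<and> A \<union> B \<subset> verts G \<longrightarrow>
      int (cut_degree (G \<restriction> (verts G - B)) A) \<ge> int q - int p * int (card B))"

definition orientation_of :: "'a pair_pre_digraph \<Rightarrow> 'a pair_pre_digraph \<Rightarrow> bool" where
  "orientation_of D G \<longleftrightarrow> pverts D = pverts G \<and>
    parcs D \<union> (parcs D)\<inverse> = parcs G \<and> parcs D \<inter> (parcs D)\<inverse> = {}"

definition smooth :: "('a, 'b) pre_digraph \<Rightarrow> bool" where
  "smooth D \<longleftrightarrow> (\<forall>v \<in> verts D. \<bar>int (out_degree D v) - int (in_degree D v)\<bar> \<le> 1)"

definition set_in_degree :: "('a, 'b) pre_digraph \<Rightarrow> 'a set \<Rightarrow> nat" where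
  "set_in_degree D X = card {e \<in> arcs D. tail D e \<notin> X \<and> head D e \<in> X}"

definition arc_strong :: "nat \<Rightarrow> ('a, 'b) pre_digraph \<Rightarrow> bool" where
  "arc_strong t D \<longleftrightarrow> (\<forall>X. X \<noteq> {} \<and> X \<subset> verts D \<longrightarrow> set_in_degree D X \<ge> t)"

end

theory Submission
  imports Defs "HOL-Library.Multiset"
begin

text \<open>Let \<open>a = 2k + 1\<close> and \<open>b = 4k + 1\<close>. The connectivity hypothesis makes the union of two matroids on
  the edges have full rank: the count matroid of the edge sets with at most \<open>a |X| - b\<close> edges inside each
  \<open>X\<close> with \<open>|X| \<ge> 2\<close>, and the graphic matroid. So \<open>G\<close> contains a tight graph \<open>H\<close> and, disjoint from it, a
  spanning tree. Removing from \<open>G\<close> a subset of the tree that meets every vertex in the parity of its degree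
  leaves an Eulerian graph \<open>K\<close> containing \<open>H\<close>. Counting in \<open>H\<close> shows that \<open>K - v\<close> is \<open>2k\<close>-edge-connected
  for every \<open>v\<close>, and that \<open>K\<close> has at least \<open>b\<close>, hence at least \<open>4k + 2\<close>, edges in every cut with two
  vertices on both sides. Nash-Williams' pairing of the odd vertices of \<open>K - v\<close>, which are the neighbours
  of \<open>v\<close>, pairs the edges of \<open>K\<close> at \<open>v\<close>. An orientation in which every such pair passes through its vertex
  is Eulerian on \<open>K\<close> and \<open>k\<close>-arc-strong after the removal of any vertex. The removed edges are oriented
  smoothly; the cuts around single vertices are then large because all degrees are at least \<open>8k + 4\<close>.\<close>

section \<open>Splitting off and odd vertex pairings\<close>

text \<open>The difficulty is that the bound on \<open>G - v\<close> has to hold for all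
  \<open>v\<close> in one orientation. Pairing the edges at each vertex separately removes it: the
  pairing at \<open>v\<close> is chosen from \<open>K - v\<close> alone, pairings at different
  vertices do not interfere, and together they split the edges into closed trails, so an orientation
  that follows all of them exists.

  The constants come from counting. \<open>H\<close> has \<open>a |V| - b\<close> edges, and a
  vertex set of size at least two spans at most \<open>a |X| - b\<close> of them; a cut into two
  such sets therefore has at least \<open>b\<close> edges. For a cut of \<open>H - v\<close> the
  vertex \<open>v\<close> is put on both sides, which costs another \<open>a\<close> and leaves
  \<open>b - a = 2k\<close>. The value \<open>b = 2a - 1\<close> is the largest one that still
  allows an edge between two vertices. The tree serves parity only: it contains a T-join for every
  even set T, and being disjoint from \<open>H\<close> it can be thinned out without touching the
  counts. The hypothesis with \<open>8k + 4 = 4a\<close> pays for the ranks of both matroids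
  together.\<close>

definition crosses :: "'a set \<Rightarrow> 'a set \<Rightarrow> bool" where
  "crosses X e \<longleftrightarrow> e \<inter> X \<noteq> {} \<and> \<not> e \<subseteq> X"

lemma crosses_pair [simp]: "crosses X {x, y} \<longleftrightarrow> (x \<in> X) \<noteq> (y \<in> X)"
  by (auto simp: crosses_def)

lemma not_crosses_singleton [simp]: "\<not> crosses X {x}"
  by (auto simp: crosses_def)

lemma not_crosses_empty [simp]: "\<not> crosses {} e"
  by (auto simp: crosses_def)

text \<open>Multisets are used because splitting off creates parallel edges even in a simple
  graph.\<close>

definition mcut :: "'a set multiset \<Rightarrow> 'a set \<Rightarrow> nat" where
  "mcut K X = size (filter_mset (crosses X) K)"

lemma mcut_simps [simp]:
  "mcut {#} X = 0"
  "mcut (add_mset e K) X = of_bool (crosses X e) + mcut K X"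
  "mcut (K + L) X = mcut K X + mcut L X"
  by (auto simp: mcut_def)

lemma mcut_empty [simp]: "mcut K {} = 0"
  by (simp add: mcut_def)

lemma size_filter_add_mset:
  "size (filter_mset P (add_mset e K)) = of_bool (P e) + size (filter_mset P K)"
  by simp

text \<open>The two ends may coincide: splitting off two parallel edges leaves a loop
  \<open>{x}\<close>, which crosses no set.\<close>

definition edges_in :: "'a set \<Rightarrow> 'a set multiset \<Rightarrow> bool" where
  "edges_in V K \<longleftrightarrow> (\<forall>e\<in>#K. \<exists>x\<in>V. \<exists>y\<in>V. e = {x, y})"

lemma edges_in_simps [simp]:
  "edges_in V {#}"
  "edges_in V (add_mset e K) \<longleftrightarrow> (\<exists>x\<in>V. \<exists>y\<in>V. e = {x, y}) \<and> edges_in V K"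
  by (auto simp: edges_in_def)

lemma edges_in_mono: "edges_in V K \<Longrightarrow> V \<subseteq> W \<Longrightarrow> edges_in W K"
  unfolding edges_in_def by (meson subsetD)

lemma mcut_posimodular:
  assumes "edges_in V K"
  shows "mcut K (X - Y) + mcut K (Y - X) \<le> mcut K X + mcut K Y"
  using assms by (induction K) auto

text \<open>Checked edge by edge over all positions of the two ends. An edge from the triple
  intersection to the outside of the union crosses all three sets on the right but only one of the
  four on the left, which pays for the factor 2.\<close>

lemma mcut_three_sets:
  assumes "edges_in V K"
  shows "mcut K (X \<inter> Y \<inter> Z) + mcut K (X - (Y \<union> Z)) + mcut K (Y - (X \<union> Z)) + mcut K (Z - (X \<union> Y))
      + 2 * size (filter_mset (\<lambda>e. crosses (X \<inter> Y \<inter> Z) e \<and> crosses (X \<union> Y \<union> Z) e) K)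
    \<le> mcut K X + mcut K Y + mcut K Z"
  using assms
proof (induction K)
  case (add e K)
  then obtain x y where e: "e = {x, y}" by auto
  have "of_bool (crosses (X \<inter> Y \<inter> Z) e) + of_bool (crosses (X - (Y \<union> Z)) e) + of_bool (crosses (Y - (X \<union> Z)) e)
      + of_bool (crosses (Z - (X \<union> Y)) e)
      + 2 * of_bool (crosses (X \<inter> Y \<inter> Z) e \<and> crosses (X \<union> Y \<union> Z) e)
    \<le> (of_bool (crosses X e) + of_bool (crosses Y e) + of_bool (crosses Z e) :: nat)"
    unfolding e by (cases "x \<in> X"; cases "x \<in> Y"; cases "x \<in> Z"; cases "y \<in> X"; cases "y \<in> Y"; cases "y \<in> Z"; simp)
  with add show ?case by (simp add: size_filter_add_mset del: filter_mset_add_mset)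
qed simp

section \<open>Splitting off at a vertex\<close>

definition star_size :: "'a set multiset \<Rightarrow> 'a \<Rightarrow> 'a set \<Rightarrow> nat" where
  "star_size K s X = size (filter_mset (\<lambda>e. \<exists>x\<in>X. e = {s, x}) K)"

text \<open>Both \<open>X\<close> and its complement in \<open>V - {s}\<close> are crossed by the
  edges between them; what differs is which of the edges at \<open>s\<close> each of them
  receives.\<close>

lemma mcut_rest:
  assumes "edges_in V K" "s \<in> V" "X \<subseteq> V - {s}"
  shows "mcut K (V - {s} - X) + 2 * star_size K s X = mcut K X + mcut K {s}"
  using assms(1)
proof (induction K)
  case (add e K)
  then obtain x y where e: "e = {x, y}" "x \<in> V" "y \<in> V" by auto
  have "of_bool (crosses (V - {s} - X) e) + 2 * of_bool (\<exists>x\<in>X. e = {s, x})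
     = (of_bool (crosses X e) + of_bool (crosses {s} e) :: nat)"
    using e assms(2,3) unfolding e(1) by (auto simp: of_bool_def doubleton_eq_iff)
  with add show ?case
    by (simp add: star_size_def size_filter_add_mset distrib_left del: filter_mset_add_mset)
qed (simp add: star_size_def)

lemma star_size_union:
  assumes "{s, v} \<in># K" "v \<in> X" "v \<in> Y"
  shows "star_size K s (X \<union> Y) + 1 \<le> star_size K s X + star_size K s Y"
proof -
  obtain L where K: "K = add_mset {s, v} L" using assms(1) by (metis multi_member_split)
  have "star_size L s (X \<union> Y) \<le> star_size L s X + star_size L s Y"
    unfolding star_size_def by (induction L) auto
  then show ?thesis using assms(2,3) unfolding K by (auto simp: star_size_def)
qed

lemma star_size_full:
  assumes "edges_in V K" "s \<in> V" "\<And>w. w \<in> V - {s} \<Longrightarrow> {s, w} \<in># K \<Longrightarrow> w \<in> X"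
  shows "mcut K {s} \<le> star_size K s X"
proof -
  have *: "\<exists>x\<in>X. e = {s, x}" if e: "e \<in># K" "crosses {s} e" for e
  proof -
    obtain x y where xy: "e = {x, y}" "x \<in> V" "y \<in> V" using e(1) assms(1) by (auto simp: edges_in_def)
    show "\<exists>x\<in>X. e = {s, x}" using e xy assms(3)[of x] assms(3)[of y] by (auto simp: insert_commute)
  qed
  then show ?thesis unfolding mcut_def star_size_def
    by (intro size_mset_mono) (simp add: filter_mset_mono_strong)
qed

text \<open>Lovasz' argument. If \<open>{s, v}\<close> cannot be split off with any other edge at
  \<open>s\<close>, each of those edges ends in a dangerous set containing \<open>v\<close>. A
  dangerous set receives at most half of the edges at \<open>s\<close>, and any two of them both
  count \<open>{s, v}\<close>, so two never suffice. Three of them contradict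
  \<open>mcut_three_sets\<close>, as \<open>8 * k + 2 \<le> 6 * k + 3\<close> fails for
  \<open>k \<ge> 1\<close>.\<close>

lemma splittable_pair:
  assumes V: "finite V" "s \<in> V" and K: "edges_in V K" and even: "even (mcut K {s})"
    and pos: "mcut K {s} > 0" and k: "k \<ge> 1"
    and conn: "\<And>X. X \<subset> V - {s} \<Longrightarrow> X \<noteq> {} \<Longrightarrow> 2 * k \<le> mcut K X"
  obtains u v L where "u \<in> V - {s}" "v \<in> V - {s}" "K = add_mset {s, u} (add_mset {s, v} L)"
    "\<And>X. X \<subset> V - {s} \<Longrightarrow> X \<noteq> {} \<Longrightarrow> 2 * k \<le> mcut (add_mset {u, v} L) X"
proof (rule ccontr)
  note main = that
  assume no: "\<not> thesis"
  obtain v where v: "v \<in> V - {s}" "{s, v} \<in># K"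
    using star_size_full[OF K V(2), of "{}"] pos by (fastforce simp: star_size_def)
  define K1 where "K1 = K - {#{s, v}#}"
  have K1: "K = add_mset {s, v} K1" using v by (simp add: K1_def)
  \<comment> \<open>Splitting off a pair with both ends in \<open>X\<close> lowers the cut by two,
    so exactly the cuts up to \<open>2 * k + 1\<close> can fall below \<open>2 * k\<close>.\<close>
  define dangerous where "dangerous X \<longleftrightarrow> X \<subset> V - {s} \<and> v \<in> X \<and> mcut K X \<le> 2 * k + 1" for X
  \<comment> \<open>One copy of \<open>{s, v}\<close> has been removed, so \<open>v\<close> belongs
    to \<open>L\<close> exactly if this edge has a parallel copy.\<close>
  define L where "L = {u \<in> V - {s}. {s, u} \<in># K1}"
  have cover: "\<exists>X. dangerous X \<and> u \<in> X" if u: "u \<in> L" for u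
  proof -
    obtain M where M: "K1 = add_mset {s, u} M" using u unfolding L_def by (metis (no_types, lifting) mem_Collect_eq multi_member_split)
    have "\<exists>X. X \<subset> V - {s} \<and> X \<noteq> {} \<and> \<not> 2 * k \<le> mcut (add_mset {v, u} M) X"
    proof (rule ccontr)
      assume neg: "\<not> ?thesis"
      have thesis
      proof (rule main[of v u M])
        show "v \<in> V - {s}" by (fact v)
        show "u \<in> V - {s}" using u by (simp add: L_def)
        show "K = add_mset {s, v} (add_mset {s, u} M)" by (simp only: K1 M)
      qed (use neg in blast)
      with no show False by blast
    qed
    then obtain X where X: "X \<subset> V - {s}" "X \<noteq> {}" "mcut (add_mset {v, u} M) X < 2 * k"
      by (meson not_le)
    have "2 * k \<le> mcut K X" by (rule conn[OF X(1,2)])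
    moreover have "s \<notin> X" using X by auto
    ultimately have "u \<in> X \<and> v \<in> X \<and> mcut K X \<le> 2 * k + 1"
      using X(3) unfolding K1 M by (cases "u \<in> X"; cases "v \<in> X"; simp)
    with X(1) show ?thesis unfolding dangerous_def by blast
  qed
  have small: "2 * star_size K s X \<le> mcut K {s}" if "dangerous X" for X
  proof -
    have "2 * k \<le> mcut K (V - {s} - X)"
      using that by (intro conn) (auto simp: dangerous_def)
    moreover have "mcut K X \<le> 2 * k + 1" using that by (auto simp: dangerous_def)
    moreover have "mcut K (V - {s} - X) + 2 * star_size K s X = mcut K X + mcut K {s}"
      using that by (intro mcut_rest[OF K V(2)]) (auto simp: dangerous_def)
    ultimately have "2 * star_size K s X \<le> mcut K {s} + 1" by linarith
    \<comment> \<open>The surplus 1 of a dangerous set is absorbed by the even degree of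
      \<open>s\<close>.\<close>
    then show ?thesis using even by presburger
  qed
  have two: "\<exists>u\<in>L. u \<notin> X \<union> Y" if "dangerous X" "dangerous Y" for X Y
  proof (rule ccontr)
    assume "\<not> ?thesis"
    then have "mcut K {s} \<le> star_size K s (X \<union> Y)"
      using that v K1 by (intro star_size_full[OF K V(2)]) (auto simp: L_def dangerous_def doubleton_eq_iff)
    moreover have "star_size K s (X \<union> Y) + 1 \<le> star_size K s X + star_size K s Y"
      using that by (intro star_size_union[OF v(2)]) (auto simp: dangerous_def)
    ultimately show False using small[OF that(1)] small[OF that(2)] by linarith
  qed
  have Lne: "L \<noteq> {}"
  proof
    assume "L = {}"
    then have "mcut K {s} \<le> star_size K s {v}"
      using v K1 by (intro star_size_full[OF K V(2)]) (auto simp: L_def doubleton_eq_iff)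
    moreover have "star_size K1 s {v} = 0"
      using \<open>L = {}\<close> v by (auto simp: star_size_def L_def)
    moreover have "star_size K s {v} = 1 + star_size K1 s {v}"
      unfolding K1 star_size_def by simp
    ultimately have "mcut K {s} \<le> 1" by linarith
    then show False using even pos by presburger
  qed
  define covers where "covers C \<longleftrightarrow> (\<forall>X\<in>C. dangerous X) \<and> L \<subseteq> \<Union>C" for C
  have "covers (Collect dangerous)" using cover by (auto simp: covers_def)
  moreover have "finite (Collect dangerous)"
    by (rule finite_subset[of _ "Pow V"]) (use V in \<open>auto simp: dangerous_def\<close>)
  ultimately have "covers (Collect dangerous) \<and> finite (Collect dangerous)" by blast
  \<comment> \<open>In a cover of least cardinality each member has a vertex lying in no other
    member; this makes the three differences below nonempty.\<close>
  from ex_has_least_nat[of "\<lambda>C. covers C \<and> finite C", OF this, of card]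
  obtain C where C: "covers C" "finite C" and Cleast: "\<And>C'. covers C' \<Longrightarrow> finite C' \<Longrightarrow> card C \<le> card C'"
    by blast
  have Cmin: "\<not> covers C'" if "C' \<subset> C" for C'
    using Cleast[of C'] psubset_card_mono[OF C(2) that] finite_subset[of C' C] C(2) that by fastforce
  have priv: "\<exists>u\<in>X. \<forall>Y\<in>C. Y \<noteq> X \<longrightarrow> u \<notin> Y" if "X \<in> C" for X
  proof -
    have "\<not> covers (C - {X})" using that by (intro Cmin) auto
    then show ?thesis using C(1) unfolding covers_def by blast
  qed
  have C2: "\<not> C \<subseteq> {X, Y}" if "dangerous X" "dangerous Y" for X Y
    using two[OF that] C(1) unfolding covers_def by blast
  have dC: "dangerous X" if "X \<in> C" for X using C(1) that by (simp add: covers_def)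
  obtain X where X: "X \<in> C" using Lne C(1) unfolding covers_def by blast
  obtain Y where Y: "Y \<in> C" "X \<noteq> Y" using C2[OF dC[OF X] dC[OF X]] by blast
  obtain Z where Z: "Z \<in> C" "X \<noteq> Z" "Y \<noteq> Z" using C2[OF dC[OF X] dC[OF Y(1)]] by blast
  have dXYZ: "dangerous X" "dangerous Y" "dangerous Z" using X Y Z dC by blast+
  have vXYZ: "v \<in> X" "v \<in> Y" "v \<in> Z" and sub: "X \<subset> V - {s}" "Y \<subset> V - {s}" "Z \<subset> V - {s}"
    using dXYZ unfolding dangerous_def by blast+
  have "X - (Y \<union> Z) \<noteq> {}" using priv[OF X] Y Z by blast
  then have "2 * k \<le> mcut K (X - (Y \<union> Z))" using sub by (intro conn) blast+
  moreover have "Y - (X \<union> Z) \<noteq> {}" using priv[OF Y(1)] X Y Z by blast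
  then have "2 * k \<le> mcut K (Y - (X \<union> Z))" using sub by (intro conn) blast+
  moreover have "Z - (X \<union> Y) \<noteq> {}" using priv[OF Z(1)] X Y Z by blast
  then have "2 * k \<le> mcut K (Z - (X \<union> Y))" using sub by (intro conn) blast+
  moreover have "2 * k \<le> mcut K (X \<inter> Y \<inter> Z)" using sub vXYZ by (intro conn) blast+
  moreover have "1 \<le> size (filter_mset (\<lambda>e. crosses (X \<inter> Y \<inter> Z) e \<and> crosses (X \<union> Y \<union> Z) e) K)"
    using vXYZ sub unfolding K1 by auto
  moreover have "mcut K X \<le> 2 * k + 1" "mcut K Y \<le> 2 * k + 1" "mcut K Z \<le> 2 * k + 1"
    using dXYZ by (auto simp: dangerous_def)
  moreover note mcut_three_sets[OF K, of X Y Z]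
  ultimately show False using k by linarith
qed

text \<open>Iterates \<open>splittable_pair\<close>; the degree of \<open>s\<close> drops by two
  each time and so remains even. The bound on \<open>size L\<close> serves the induction measure of
  \<open>odd_vertex_pairing\<close>.\<close>

lemma complete_splitting:
  assumes V: "finite V" "s \<in> V" and k: "k \<ge> 1"
    and "edges_in V K" "even (mcut K {s})"
    and "\<And>X. X \<subset> V - {s} \<Longrightarrow> X \<noteq> {} \<Longrightarrow> 2 * k \<le> mcut K X"
  shows "\<exists>L. edges_in (V - {s}) L \<and> size L \<le> size K \<and> (\<forall>X. mcut L X \<le> mcut K X)
    \<and> (\<forall>x. x \<noteq> s \<longrightarrow> even (mcut L {x} + mcut K {x}))
    \<and> (\<forall>X. X \<subset> V - {s} \<longrightarrow> X \<noteq> {} \<longrightarrow> 2 * k \<le> mcut L X)"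
  using assms(4-)
proof (induction "size K" arbitrary: K rule: less_induct)
  case less
  show ?case
  proof (cases "mcut K {s} = 0")
    case True
    \<comment> \<open>All edges remaining at \<open>s\<close> are loops, so dropping them changes no
      cut.\<close>
    define L where "L = filter_mset (\<lambda>e. s \<notin> e) K"
    have noncross: "\<not> crosses X e" if e: "e \<in># K" "s \<in> e" for X e
    proof -
      obtain x y where "e = {x, y}" using e less.prems(1) by (auto simp: edges_in_def)
      moreover have "\<not> crosses {s} e" using that True by (auto simp: mcut_def)
      ultimately show ?thesis using that by auto
    qed
    have eq: "mcut L X = mcut K X" for X
    proof -
      have "filter_mset (crosses X) L = filter_mset (crosses X) K"
        unfolding L_def filter_filter_mset using noncross by (intro filter_mset_cong) auto
      then show ?thesis by (simp add: mcut_def)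
    qed
    have "edges_in (V - {s}) L"
      using less.prems(1) unfolding edges_in_def L_def by fastforce
    moreover have "size L \<le> size K" unfolding L_def by (rule size_filter_mset_lesseq)
    ultimately show ?thesis using less.prems(3) by (intro exI[of _ L]) (simp add: eq)
  next
    case False
    then have pos: "mcut K {s} > 0" by simp
    obtain u v L where uv: "u \<in> V - {s}" "v \<in> V - {s}" and K: "K = add_mset {s, u} (add_mset {s, v} L)"
      and conn: "\<And>X. X \<subset> V - {s} \<Longrightarrow> X \<noteq> {} \<Longrightarrow> 2 * k \<le> mcut (add_mset {u, v} L) X"
      using splittable_pair[OF V less.prems(1,2) pos k less.prems(3)] by metis
    define K' where "K' = add_mset {u, v} L"
    have le: "mcut K' X \<le> mcut K X" for X
      unfolding K K'_def by (cases "s \<in> X"; cases "u \<in> X"; cases "v \<in> X"; simp)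
    have par: "even (mcut K' {x} + mcut K {x})" for x
      using uv unfolding K K'_def by (cases "s = x"; cases "u = x"; cases "v = x"; simp)
    have "edges_in V K'" using less.prems(1) uv unfolding K K'_def by auto
    moreover have "even (mcut K' {s})" using par[of s] less.prems(2) by simp
    moreover have "size K' < size K" unfolding K K'_def by simp
    ultimately obtain M where M: "edges_in (V - {s}) M" "size M \<le> size K'" "\<forall>X. mcut M X \<le> mcut K' X"
      "\<forall>x. x \<noteq> s \<longrightarrow> even (mcut M {x} + mcut K' {x})"
      "\<forall>X. X \<subset> V - {s} \<longrightarrow> X \<noteq> {} \<longrightarrow> 2 * k \<le> mcut M X"
      using less.hyps[of K'] conn unfolding K'_def by metis
    have "even (mcut M {x} + mcut K {x})" if "x \<noteq> s" for x
      using M(4) par[of x] that by (metis (no_types, lifting) even_add)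
    moreover have "mcut M X \<le> mcut K X" for X using M(3) le[of X] by (meson order_trans)
    moreover have "size M \<le> size K" using M(2) \<open>size K' < size K\<close> by linarith
    ultimately show ?thesis using M(1,5) by blast
  qed
qed

text \<open>Nash-Williams' odd vertex pairing for global edge connectivity. In a minimally
  \<open>2k\<close>-edge-connected multigraph a minimal tight set is a single vertex, which can be split off.\<close>

theorem odd_vertex_pairing:
  assumes "finite V" "edges_in V K"
    and "\<And>X. X \<subset> V \<Longrightarrow> X \<noteq> {} \<Longrightarrow> 2 * k \<le> mcut K X"
  shows "\<exists>M. edges_in V M \<and> (\<forall>x\<in>V. even (mcut M {x} + mcut K {x}))
    \<and> (\<forall>X. X \<subset> V \<longrightarrow> X \<noteq> {} \<longrightarrow> mcut M X + 2 * k \<le> mcut K X)"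
  using assms
proof (induction "size K + card V" arbitrary: K V rule: less_induct)
  case less
  note fin = less.prems(1) and K = less.prems(2) and conn = less.prems(3)
  show ?case
  proof (cases "\<exists>e\<in>#K. \<forall>X. X \<subset> V \<longrightarrow> X \<noteq> {} \<longrightarrow> 2 * k \<le> mcut (K - {#e#}) X")
    case True
    then obtain e where e: "e \<in># K" and c: "\<And>X. X \<subset> V \<Longrightarrow> X \<noteq> {} \<Longrightarrow> 2 * k \<le> mcut (K - {#e#}) X"
      by blast
    define L where "L = K - {#e#}"
    have KL: "K = add_mset e L" using e by (simp add: L_def)
    have "size L + card V < size K + card V" unfolding KL by simp
    moreover have "edges_in V L" using K unfolding KL by simp
    ultimately obtain M where M: "edges_in V M" "\<forall>x\<in>V. even (mcut M {x} + mcut L {x})"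
      "\<forall>X. X \<subset> V \<longrightarrow> X \<noteq> {} \<longrightarrow> mcut M X + 2 * k \<le> mcut L X"
      using less.hyps[of L V] fin c unfolding L_def by metis
    \<comment> \<open>The redundant edge is added to the pairing: it contributes equally to the cuts
      of \<open>M\<close> and of \<open>K\<close>, and twice to each parity sum.\<close>
    have "edges_in V (add_mset e M)" using M(1) K unfolding KL by simp
    moreover have "\<forall>x\<in>V. even (mcut (add_mset e M) {x} + mcut K {x})" using M(2) unfolding KL by simp
    moreover have "\<forall>X. X \<subset> V \<longrightarrow> X \<noteq> {} \<longrightarrow> mcut (add_mset e M) X + 2 * k \<le> mcut K X"
      using M(3) unfolding KL by simp
    ultimately show ?thesis by blast
  next
    case False
    have tight: "\<exists>X. X \<subset> V \<and> X \<noteq> {} \<and> mcut K X = 2 * k \<and> crosses X e" if e: "e \<in># K" for e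
    proof -
      obtain L where L: "K = add_mset e L" using e by (metis multi_member_split)
      obtain X where X: "X \<subset> V" "X \<noteq> {}" "mcut L X < 2 * k" using False e L by (metis not_le add_mset_remove_trivial)
      have "2 * k \<le> mcut K X" by (rule conn[OF X(1,2)])
      with X(3) have "crosses X e" "mcut K X = 2 * k" unfolding L by (cases "crosses X e"; simp)+
      with X show ?thesis by blast
    qed
    show ?thesis
    proof (cases "\<exists>X. X \<subset> V \<and> X \<noteq> {}")
      case False
      have "mcut K {x} = 0" if "x \<in> V" for x
      proof -
        have "V = {x}" using False that by blast
        then show ?thesis using K by (induction K) auto
      qed
      then show ?thesis using False by (intro exI[of _ "{#}"]) simp
    next
      case nontriv: True
      show ?thesis
      proof (cases "k = 0")
        case True
        then show ?thesis using K by (intro exI[of _ K]) auto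
      next
        case False
        then have k: "k \<ge> 1" by simp
        define T where "T X \<longleftrightarrow> X \<subset> V \<and> X \<noteq> {} \<and> mcut K X = 2 * k" for X
        obtain X0 where "X0 \<subset> V" "X0 \<noteq> {}" using nontriv by blast
        then have "2 * k \<le> mcut K X0" by (rule conn)
        then have "K \<noteq> {#}" using k by auto
        then obtain e where "e \<in># K" by (auto simp: multiset_nonemptyE)
        then obtain X1 where "T X1" using tight unfolding T_def by blast
        then obtain X where X: "T X" and Xmin: "\<And>Y. T Y \<Longrightarrow> card X \<le> card Y"
          using ex_has_least_nat[of T X1 card] by blast
        have Xprop: "X \<subset> V" "X \<noteq> {}" "mcut K X = 2 * k" "finite X"
          using X fin unfolding T_def by (auto intro: finite_subset)
        have nosub: "\<not> T Y" if "Y \<subset> X" for Y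
          using Xmin[of Y] psubset_card_mono[OF Xprop(4) that] by linarith
        obtain s where s: "s \<in> X" using Xprop by blast
        \<comment> \<open>Otherwise some edge inside \<open>X\<close> leaves \<open>s\<close>, since
          \<open>{s}\<close> and \<open>X - {s}\<close> together have cuts of at least
          \<open>4 * k\<close>. A tight set \<open>Y\<close> crossed by this edge then yields a
          smaller tight set, either \<open>Y\<close> itself or \<open>X - Y\<close> by
          posimodularity.\<close>
        have "X = {s}"
        proof (rule ccontr)
          assume "X \<noteq> {s}"
          then have ne: "X - {s} \<noteq> {}" using s by blast
          have "\<exists>e\<in>#K. crosses {s} e \<and> e \<subseteq> X"
          proof (rule ccontr)
            assume neg: "\<not> ?thesis"
            have "mcut K {s} + mcut K (X - {s}) \<le> mcut K X"
              using K neg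
            proof (induction K)
              case (add e K)
              then obtain x y where e: "e = {x, y}" by auto
              have "of_bool (crosses {s} e) + of_bool (crosses (X - {s}) e) \<le> (of_bool (crosses X e) :: nat)"
                using add.prems(2) s unfolding e by (cases "x \<in> X"; cases "y \<in> X"; cases "x = s"; cases "y = s"; simp)
              with add show ?case by simp
            qed simp
            moreover have "2 * k \<le> mcut K {s}" "2 * k \<le> mcut K (X - {s})"
              using Xprop s ne by (auto intro!: conn)
            ultimately show False using Xprop(3) k by linarith
          qed
          then obtain e where e: "e \<in># K" "crosses {s} e" "e \<subseteq> X" by blast
          obtain Y where Y: "Y \<subset> V" "Y \<noteq> {}" "mcut K Y = 2 * k" "crosses Y e" using tight[OF e(1)] by blast
          have XY: "X \<inter> Y \<noteq> {}" "X - Y \<noteq> {}" using Y(4) e(3) unfolding crosses_def by blast+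
          show False
          proof (cases "Y - X = {}")
            case True
            then have "Y \<subset> X" using XY by blast
            then show False using nosub Y unfolding T_def by blast
          next
            case False
            have "2 * k \<le> mcut K (X - Y)" "2 * k \<le> mcut K (Y - X)"
              using XY False Xprop Y by (auto intro!: conn)
            with mcut_posimodular[OF K, of X Y] Xprop(3) Y(3) have "mcut K (X - Y) = 2 * k" by linarith
            then have "T (X - Y)" using XY Xprop unfolding T_def by blast
            then show False using nosub[of "X - Y"] XY by blast
          qed
        qed
        \<comment> \<open>The degree \<open>2 * k\<close> is even, so \<open>s\<close> can be split
          off completely and needs no edge of the pairing.\<close>
        then have deg: "mcut K {s} = 2 * k" and sV: "s \<in> V" using Xprop by auto
        have "\<exists>L. edges_in (V - {s}) L \<and> size L \<le> size K \<and> (\<forall>X. mcut L X \<le> mcut K X)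
          \<and> (\<forall>x. x \<noteq> s \<longrightarrow> even (mcut L {x} + mcut K {x}))
          \<and> (\<forall>X. X \<subset> V - {s} \<longrightarrow> X \<noteq> {} \<longrightarrow> 2 * k \<le> mcut L X)"
          by (rule complete_splitting[OF fin sV k K]) (use deg conn in auto)
        then obtain L where L: "edges_in (V - {s}) L" "size L \<le> size K" "\<And>X. mcut L X \<le> mcut K X"
          "\<And>x. x \<noteq> s \<Longrightarrow> even (mcut L {x} + mcut K {x})"
          "\<And>X. X \<subset> V - {s} \<Longrightarrow> X \<noteq> {} \<Longrightarrow> 2 * k \<le> mcut L X" by blast
        have "card (V - {s}) < card V" using sV fin by (meson card_Diff1_less)
        then have "size L + card (V - {s}) < size K + card V" using L(2) by linarith
        from less.hyps[OF this _ L(1,5)] fin obtain M where M: "edges_in (V - {s}) M"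
          "\<And>x. x \<in> V - {s} \<Longrightarrow> even (mcut M {x} + mcut L {x})"
          "\<And>X. X \<subset> V - {s} \<Longrightarrow> X \<noteq> {} \<Longrightarrow> mcut M X + 2 * k \<le> mcut L X" by blast
        have Ms: "mcut M X = mcut M (X - {s})" for X
          using M(1) by (induction M) auto
        have M0: "mcut M (V - {s}) = 0"
          using M(1) by (induction M) auto
        have "edges_in V M" using M(1) by (rule edges_in_mono) blast
        moreover have "even (mcut M {x} + mcut K {x})" if "x \<in> V" for x
        proof (cases "x = s")
          case True
          then show ?thesis using deg Ms[of "{s}"] by simp
        next
          case False
          then show ?thesis using M(2)[of x] L(4)[of x] that by simp
        qed
        moreover have "mcut M X + 2 * k \<le> mcut K X" if X: "X \<subset> V" "X \<noteq> {}" for X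
        proof (cases "X - {s} \<subset> V - {s} \<and> X - {s} \<noteq> {}")
          case True
          have "mcut L X = mcut L (X - {s})" using L(1) by (induction L) auto
          then show ?thesis using M(3)[of "X - {s}"] True Ms[of X] L(3)[of X] by linarith
        next
          case False
          \<comment> \<open>In both cases no edge of \<open>M\<close> crosses \<open>X\<close>,
            because \<open>M\<close> avoids \<open>s\<close>; the connectivity of \<open>K\<close>
            then suffices.\<close>
          then have "X = {s} \<or> X - {s} = V - {s}" using X by blast
          then have "mcut M X = 0"
          proof
            assume "X = {s}"
            then show ?thesis using Ms[of "{s}"] by simp
          next
            assume "X - {s} = V - {s}"
            then show ?thesis using Ms[of X] M0 by simp
          qed
          then show ?thesis using conn[OF X] by simp
        qed
        ultimately show ?thesis by blast
      qed
    qed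
  qed
qed

section \<open>From a pairing multigraph to an involution\<close>

lemma matching_reduction:
  assumes "edges_in V M"
  obtains P where "edges_in V P" "\<And>x. even (mcut P {x} + mcut M {x})" "\<And>X. mcut P X \<le> mcut M X"
    "\<And>x. {x} \<notin># P" "\<And>e f L. P = add_mset e (add_mset f L) \<Longrightarrow> e \<inter> f = {}"
proof -
  \<comment> \<open>A multigraph of least size satisfying \<open>Q\<close> is a matching: a loop
    could be dropped, and two edges meeting in \<open>z\<close> could be replaced by one edge
    between their other ends.\<close>
  define Q where "Q P \<longleftrightarrow> edges_in V P \<and> (\<forall>x. even (mcut P {x} + mcut M {x})) \<and> (\<forall>X. mcut P X \<le> mcut M X)" for P
  have "Q M" using assms by (simp add: Q_def)
  then obtain P where P: "Q P" and Pmin: "\<And>P'. Q P' \<Longrightarrow> size P \<le> size P'"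
    using ex_has_least_nat[of Q M size] by blast
  show thesis
  proof (rule that[of P])
    show "edges_in V P" "even (mcut P {x} + mcut M {x})" "mcut P X \<le> mcut M X" for x X
      using P by (auto simp: Q_def)
    show "{x} \<notin># P" for x
    proof
      assume "{x} \<in># P"
      then obtain L where L: "P = add_mset {x} L" by (metis multi_member_split)
      have "Q L" using P unfolding Q_def L by simp
      from Pmin[OF this] show False unfolding L by simp
    qed
    show "e \<inter> f = {}" if P2: "P = add_mset e (add_mset f L)" for e f L
    proof (rule ccontr)
      assume "e \<inter> f \<noteq> {}"
      then obtain z where z: "z \<in> e" "z \<in> f" by blast
      have "edges_in V P" using P by (simp add: Q_def)
      then obtain a b c d where "e = {a, b}" "f = {c, d}" "a \<in> V" "b \<in> V" "c \<in> V" "d \<in> V"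
        unfolding P2 by auto
      then obtain x y where xy: "e = {z, x}" "f = {z, y}" "x \<in> V" "y \<in> V" using z by auto
      have "even (mcut (add_mset {x, y} L) {v} + mcut M {v})" for v
      proof -
        have "even (mcut P {v} + mcut M {v})" using P by (simp add: Q_def)
        moreover have "even (mcut (add_mset {x, y} L) {v} + mcut P {v})"
          unfolding P2 xy by (cases "x = v"; cases "y = v"; cases "z = v"; simp)
        ultimately show ?thesis by simp
      qed
      moreover have "mcut (add_mset {x, y} L) X \<le> mcut M X" for X
      proof -
        have "mcut (add_mset {x, y} L) X \<le> mcut P X"
          unfolding P2 xy by (cases "x \<in> X"; cases "y \<in> X"; cases "z \<in> X"; simp)
        also have "\<dots> \<le> mcut M X" using P by (simp add: Q_def)
        finally show ?thesis .
      qed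
      moreover have "edges_in V (add_mset {x, y} L)" using \<open>edges_in V P\<close> xy unfolding P2 by auto
      ultimately have "Q (add_mset {x, y} L)" by (simp add: Q_def)
      from Pmin[OF this] show False unfolding P2 by simp
    qed
  qed
qed

text \<open>After the reduction to a matching, the odd vertices of \<open>M\<close> are the matched
  ones and \<open>\<pi>\<close> moves along the matching edges. Vertices of \<open>X\<close> with
  their partner outside \<open>X\<close> lie on different edges across \<open>X\<close>.\<close>

lemma odd_vertex_involution:
  assumes "edges_in V M"
  obtains \<pi> where "\<And>x. odd (mcut M {x}) \<Longrightarrow> \<pi> x \<noteq> x \<and> odd (mcut M {\<pi> x}) \<and> \<pi> (\<pi> x) = x"
    "\<And>X. card {x \<in> X. odd (mcut M {x}) \<and> \<pi> x \<notin> X} \<le> mcut M X"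
proof -
  obtain P where P: "edges_in V P" "\<And>x. even (mcut P {x} + mcut M {x})" "\<And>X. mcut P X \<le> mcut M X"
    and noloop: "\<And>x. {x} \<notin># P" and disj: "\<And>e f L. P = add_mset e (add_mset f L) \<Longrightarrow> e \<inter> f = {}"
    using matching_reduction[OF assms] by metis
  have par: "odd (mcut M {x}) \<longleftrightarrow> odd (mcut P {x})" for x using P(2)[of x] by auto
  have deg: "mcut P {x} = 1 \<and> (\<forall>z. {x, z} \<in># P \<longrightarrow> z = y)" if xy: "{x, y} \<in># P" for x y
  proof -
    obtain L where L: "P = add_mset {x, y} L" using xy by (metis multi_member_split)
    have "x \<noteq> y" using noloop xy by auto
    have no: "x \<notin> f" if "f \<in># L" for f
    proof -
      obtain L' where "L = add_mset f L'" using \<open>f \<in># L\<close> by (metis multi_member_split)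
      then have "{x, y} \<inter> f = {}" using disj L by blast
      then show ?thesis by blast
    qed
    then have "mcut L {x} = 0" by (auto simp: mcut_def crosses_def)
    then have "mcut P {x} = 1" using \<open>x \<noteq> y\<close> by (simp add: L)
    moreover have "z = y" if "{x, z} \<in># P" for z
      using that no \<open>x \<noteq> y\<close> unfolding L by (auto simp: doubleton_eq_iff)
    ultimately show ?thesis by blast
  qed
  have ex: "\<exists>y. {x, y} \<in># P" if "odd (mcut P {x})" for x
  proof -
    have "filter_mset (crosses {x}) P \<noteq> {#}" using that unfolding mcut_def by (metis even_zero size_empty)
    then obtain e where e: "e \<in># P" "crosses {x} e" by auto
    then obtain a b where "e = {a, b}" using P(1) unfolding edges_in_def by meson
    then show ?thesis using e by (auto simp: insert_commute)
  qed
  define \<pi> where "\<pi> x = (SOME y. {x, y} \<in># P)" for x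
  have \<pi>: "{x, \<pi> x} \<in># P" if "odd (mcut P {x})" for x
    unfolding \<pi>_def using ex[OF that] by (rule someI_ex)
  show thesis
  proof (rule that[of \<pi>])
    fix x assume "odd (mcut M {x})"
    then have x: "{x, \<pi> x} \<in># P" using \<pi> par by blast
    then have x': "{\<pi> x, x} \<in># P" by (simp add: insert_commute)
    have odd: "odd (mcut P {\<pi> x})" using deg[OF x'] by simp
    have "\<pi> (\<pi> x) = x" using deg[OF x'] \<pi>[OF odd] by blast
    moreover have "\<pi> x \<noteq> x" using x noloop by (metis insert_absorb2)
    ultimately show "\<pi> x \<noteq> x \<and> odd (mcut M {\<pi> x}) \<and> \<pi> (\<pi> x) = x" using odd par by blast
  next
    fix X
    let ?B = "{x \<in> X. odd (mcut M {x}) \<and> \<pi> x \<notin> X}"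
    have "card ?B \<le> card (set_mset (filter_mset (crosses X) P))"
    proof (rule card_inj_on_le)
      show "inj_on (\<lambda>x. {x, \<pi> x}) ?B" by (auto simp: inj_on_def doubleton_eq_iff)
      show "(\<lambda>x. {x, \<pi> x}) ` ?B \<subseteq> set_mset (filter_mset (crosses X) P)"
        using \<pi> par by auto
    qed simp
    also have "\<dots> \<le> mcut P X" unfolding mcut_def
      by (metis finite_set_mset mset_set_set_mset_msubset size_mset_mono size_mset_set)
    also have "\<dots> \<le> mcut M X" by (rule P(3))
    finally show "card ?B \<le> mcut M X" .
  qed
qed

section \<open>Orientations from transitions\<close>

text \<open>\<open>S\<close> contains both directions of every edge. \<open>\<sigma>\<close> sends
  an arc to its successor on the trail given by \<open>\<pi>\<close>, and \<open>\<rho>\<close>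
  reverses it. A trail never runs through the same edge in both directions, so a largest set of arcs
  closed under \<open>\<sigma>\<close> and without opposite pairs contains one direction of each
  edge.\<close>

lemma transition_orientation:
  fixes S :: "('b \<times> 'b) set" and \<pi> :: "'b \<Rightarrow> 'b \<Rightarrow> 'b"
  assumes fin: "finite S" and sym: "\<And>u v. (u, v) \<in> S \<Longrightarrow> (v, u) \<in> S" and irr: "\<And>u. (u, u) \<notin> S"
    and \<pi>: "\<And>u v. (u, v) \<in> S \<Longrightarrow> (\<pi> v u, v) \<in> S \<and> \<pi> v u \<noteq> u \<and> \<pi> v (\<pi> v u) = u"
  obtains D where "D \<union> D\<inverse> = S" "D \<inter> D\<inverse> = {}"
    "\<And>u v. (u, v) \<in> S \<Longrightarrow> (u, v) \<in> D \<longleftrightarrow> (v, \<pi> v u) \<in> D"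
proof -
  define \<sigma> where "\<sigma> d = (snd d, \<pi> (snd d) (fst d))" for d
  define \<rho> where "\<rho> d = (snd d, fst d)" for d :: "'b \<times> 'b"
  have \<sigma>S: "\<sigma> d \<in> S" if "d \<in> S" for d using that \<pi> sym by (cases d) (auto simp: \<sigma>_def)
  have \<rho>S: "\<rho> d \<in> S" if "d \<in> S" for d using that sym by (cases d) (auto simp: \<rho>_def)
  have \<sigma>nS: "(\<sigma> ^^ n) d \<in> S" if "d \<in> S" for d n using that \<sigma>S by (induction n) auto
  have inj: "inj_on \<sigma> S"
    by (rule inj_onI) (metis \<pi> \<sigma>_def prod.collapse prod.inject)
  have injn: "(\<sigma> ^^ n) d = (\<sigma> ^^ n) d' \<Longrightarrow> d = d'" if "d \<in> S" "d' \<in> S" for d d' n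
  proof (induction n)
    case (Suc n)
    then show ?case using inj_onD[OF inj, of "(\<sigma> ^^ n) d" "(\<sigma> ^^ n) d'"] \<sigma>nS that by simp
  qed simp
  \<comment> \<open>Reversal turns \<open>\<sigma>\<close> into its inverse: reversed trails are
    trails.\<close>
  have conj1: "\<sigma> (\<rho> (\<sigma> d)) = \<rho> d" if "d \<in> S" for d
    using that \<pi> by (cases d) (auto simp: \<sigma>_def \<rho>_def)
  have conjn: "(\<sigma> ^^ n) (\<rho> ((\<sigma> ^^ n) d)) = \<rho> d" if "d \<in> S" for d n
  proof (induction n)
    case (Suc n)
    have "(\<sigma> ^^ Suc n) (\<rho> ((\<sigma> ^^ Suc n) d)) = (\<sigma> ^^ n) (\<sigma> (\<rho> (\<sigma> ((\<sigma> ^^ n) d))))"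
      by (simp add: funpow_swap1)
    also have "\<dots> = \<rho> d" using Suc conj1[OF \<sigma>nS[OF that]] by simp
    finally show ?case .
  qed simp
  have orbit: "\<rho> d \<noteq> (\<sigma> ^^ N) d" if d: "d \<in> S" for d N
  proof
    assume eq: "\<rho> d = (\<sigma> ^^ N) d"
    \<comment> \<open>If the trail from \<open>d\<close> reached its own reversal, then halfway
      along it an arc would be equal to its reversal (\<open>N\<close> even) or be followed by it
      (\<open>N\<close> odd). The first is excluded by irreflexivity, the second because
      \<open>\<pi>\<close> has no fixed point.\<close>
    define j where "j = N div 2"
    define d' where "d' = (\<sigma> ^^ j) d"
    have d': "d' \<in> S" using \<sigma>nS d by (simp add: d'_def)
    obtain a b where ab: "d' = (a, b)" by (cases d')
    then have "(a, b) \<in> S" "a \<noteq> b" using d' irr by auto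
    then have \<rho>d': "\<rho> d' \<noteq> d'" "\<rho> d' \<noteq> \<sigma> d'"
      using \<pi>[of a b] unfolding ab \<rho>_def \<sigma>_def by auto
    have "N = j + j \<or> N = j + Suc j" unfolding j_def by presburger
    then show False
    proof
      assume "N = j + j"
      then have "(\<sigma> ^^ j) (\<rho> d') = (\<sigma> ^^ j) d'" using eq conjn[OF d, of j] by (simp add: d'_def funpow_add)
      then have "\<rho> d' = d'" by (rule injn[OF \<rho>S[OF d'] d'])
      then show False using \<rho>d' by blast
    next
      assume "N = j + Suc j"
      then have "(\<sigma> ^^ j) (\<rho> d') = (\<sigma> ^^ j) (\<sigma> d')"
        using eq conjn[OF d, of j] by (simp add: d'_def funpow_add funpow_swap1)
      then have "\<rho> d' = \<sigma> d'" by (rule injn[OF \<rho>S[OF d'] \<sigma>S[OF d']])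
      then show False using \<rho>d' by blast
    qed
  qed
  define ok where "ok D \<longleftrightarrow> D \<subseteq> S \<and> \<sigma> ` D \<subseteq> D \<and> (\<forall>d\<in>D. \<rho> d \<notin> D)" for D
  have "ok {}" by (simp add: ok_def)
  moreover have "\<forall>D. ok D \<longrightarrow> card D < Suc (card S)" using fin by (auto simp: ok_def card_mono less_Suc_eq_le)
  ultimately obtain D where D: "ok D" and Dmax: "\<And>D'. ok D' \<Longrightarrow> card D' \<le> card D"
    using ex_has_greatest_nat[of ok "{}" card "Suc (card S)"] by blast
  have DS: "D \<subseteq> S" and closed: "\<And>d. d \<in> D \<Longrightarrow> \<sigma> d \<in> D" and asym: "\<And>d. d \<in> D \<Longrightarrow> \<rho> d \<notin> D"
    using D unfolding ok_def by blast+
  have finD: "finite D" using DS fin by (rule finite_subset)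
  have closedn: "(\<sigma> ^^ n) d \<in> D" if "d \<in> D" for d n using that closed by (induction n) auto
  have \<rho>\<rho>: "\<rho> (\<rho> d) = d" for d by (simp add: \<rho>_def)
  have total: "d \<in> D \<or> \<rho> d \<in> D" if d: "d \<in> S" for d
  proof (rule ccontr)
    assume neg: "\<not> ?thesis"
    \<comment> \<open>The forward orbit suffices: if the reversal of one of its arcs were in
      \<open>D\<close>, closure under \<open>\<sigma>\<close> would bring \<open>\<rho> d\<close>
      into \<open>D\<close>.\<close>
    define Orb where "Orb = range (\<lambda>n. (\<sigma> ^^ n) d)"
    have "ok (D \<union> Orb)"
      unfolding ok_def
    proof (intro conjI ballI)
      show "D \<union> Orb \<subseteq> S" using DS \<sigma>nS d unfolding Orb_def by blast
      have "\<sigma> ((\<sigma> ^^ n) d) = (\<sigma> ^^ Suc n) d" for n by simp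
      then have "\<sigma> ` Orb \<subseteq> Orb" unfolding Orb_def by blast
      then show "\<sigma> ` (D \<union> Orb) \<subseteq> D \<union> Orb" using closed by blast
      have OD: "\<rho> ((\<sigma> ^^ n) d) \<notin> D" for n
      proof
        assume "\<rho> ((\<sigma> ^^ n) d) \<in> D"
        then have "(\<sigma> ^^ n) (\<rho> ((\<sigma> ^^ n) d)) \<in> D" by (rule closedn)
        then show False using conjn[OF d] neg by simp
      qed
      have OO: "\<rho> ((\<sigma> ^^ n) d) \<noteq> (\<sigma> ^^ m) d" for n m
      proof
        assume "\<rho> ((\<sigma> ^^ n) d) = (\<sigma> ^^ m) d"
        then have "\<rho> d = (\<sigma> ^^ (n + m)) d" using conjn[OF d, of n] by (simp add: funpow_add)
        then show False using orbit d by blast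
      qed
      show "\<rho> c \<notin> D \<union> Orb" if c: "c \<in> D \<union> Orb" for c
      proof (cases "c \<in> D")
        case True
        have "\<rho> c \<notin> Orb"
        proof
          assume "\<rho> c \<in> Orb"
          then obtain n where "\<rho> c = (\<sigma> ^^ n) d" unfolding Orb_def by blast
          then show False using OD[of n] True \<rho>\<rho>[of c] by simp
        qed
        then show ?thesis using asym[OF True] by blast
      next
        case False
        then obtain n where "c = (\<sigma> ^^ n) d" using c unfolding Orb_def by blast
        then show ?thesis using OD[of n] OO[of n] unfolding Orb_def by blast
      qed
    qed
    then have "card (D \<union> Orb) \<le> card D" by (rule Dmax)
    moreover have "finite (D \<union> Orb)" using \<sigma>nS d unfolding Orb_def by (intro finite_subset[OF _ fin]) (use DS in blast)
    ultimately have "D \<union> Orb = D" using card_seteq[of "D \<union> Orb" D] by blast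
    moreover have "d \<in> Orb" unfolding Orb_def by (metis funpow_0 rangeI)
    ultimately show False using neg by blast
  qed
  \<comment> \<open>An injective map of the finite set \<open>D\<close> into itself permutes it.
    This gives the direction from \<open>(v, \<pi> v u)\<close> back to
    \<open>(u, v)\<close>.\<close>
  have surj: "\<sigma> ` D = D"
    by (rule card_subset_eq[OF finD])
      (use closed in blast, rule card_image, rule inj_on_subset[OF inj DS])
  show thesis
  proof (rule that[of D])
    show "D \<union> D\<inverse> = S" using DS sym total unfolding \<rho>_def by force
    show "D \<inter> D\<inverse> = {}" using asym unfolding \<rho>_def by force
    fix u v assume uv: "(u, v) \<in> S"
    show "(u, v) \<in> D \<longleftrightarrow> (v, \<pi> v u) \<in> D"
    proof
      assume "(u, v) \<in> D"
      then show "(v, \<pi> v u) \<in> D" using closed[of "(u, v)"] by (simp add: \<sigma>_def)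
    next
      assume "(v, \<pi> v u) \<in> D"
      then obtain d where d: "d \<in> D" "\<sigma> d = \<sigma> (u, v)" using surj by (metis (no_types, lifting) \<sigma>_def fst_conv snd_conv imageE)
      then have "d = (u, v)" using inj_onD[OF inj] uv DS by blast
      then show "(u, v) \<in> D" using d by simp
    qed
  qed
qed

section \<open>Packing a tight subgraph and a spanning tree\<close>

definition induced :: "'a set set \<Rightarrow> 'a set \<Rightarrow> 'a set set" where
  "induced H X = {e \<in> H. e \<subseteq> X}"

text \<open>Sets with fewer than two vertices are exempt because \<open>b\<close> may exceed
  \<open>a\<close>. For \<open>a = b = 1\<close> the sparse sets are the forests, and tightness of
  \<open>V\<close> means a spanning tree.\<close>

definition sparse :: "'a set \<Rightarrow> nat \<Rightarrow> nat \<Rightarrow> 'a set set \<Rightarrow> bool" where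
  "sparse V a b H \<longleftrightarrow> (\<forall>X. X \<subseteq> V \<longrightarrow> 2 \<le> card X \<longrightarrow> card (induced H X) + b \<le> a * card X)"

definition tight :: "'a set \<Rightarrow> nat \<Rightarrow> nat \<Rightarrow> 'a set set \<Rightarrow> 'a set \<Rightarrow> bool" where
  "tight V a b H X \<longleftrightarrow> X \<subseteq> V \<and> 2 \<le> card X \<and> card (induced H X) + b = a * card X"

lemma sparseD: "sparse V a b H \<Longrightarrow> X \<subseteq> V \<Longrightarrow> 2 \<le> card X \<Longrightarrow> card (induced H X) + b \<le> a * card X"
  by (simp add: sparse_def)

lemma finite_induced: "finite H \<Longrightarrow> finite (induced H X)"
  by (simp add: induced_def)

lemma induced_Int: "induced H X \<inter> induced H Y = induced H (X \<inter> Y)"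
  by (auto simp: induced_def)

text \<open>Uncrossing by supermodularity of the number of induced edges. The bound
  \<open>meet\<close> is a separate assumption because sparsity is silent about intersections with
  fewer than two vertices. The last conclusion says that no edge of \<open>H\<close> joins
  \<open>X - Y\<close> to \<open>Y - X\<close>.\<close>

lemma tight_Int_Un:
  assumes fin: "finite V" "finite H" and sp: "sparse V a b H"
    and X: "tight V a b H X" and Y: "tight V a b H Y"
    and meet: "card (induced H (X \<inter> Y)) + b \<le> a * card (X \<inter> Y)"
  shows "card (induced H (X \<inter> Y)) + b = a * card (X \<inter> Y)" "tight V a b H (X \<union> Y)"
    "induced H (X \<union> Y) = induced H X \<union> induced H Y"
proof -
  have sub: "X \<subseteq> V" "Y \<subseteq> V" "2 \<le> card X" and
    eqs: "card (induced H X) + b = a * card X" "card (induced H Y) + b = a * card Y"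
    using X Y by (auto simp: tight_def)
  have finXY: "finite X" "finite Y" using sub fin by (auto intro: finite_subset)
  have "card X \<le> card (X \<union> Y)" using finXY by (intro card_mono) auto
  then have c2: "2 \<le> card (X \<union> Y)" using sub by simp
  have U: "card (induced H (X \<union> Y)) + b \<le> a * card (X \<union> Y)"
    using sparseD[OF sp, of "X \<union> Y"] sub c2 by simp
  have le: "induced H X \<union> induced H Y \<subseteq> induced H (X \<union> Y)" by (auto simp: induced_def)
  have finU: "finite (induced H (X \<union> Y))" using fin(2) by (rule finite_induced)
  have c: "card (induced H X) + card (induced H Y)
      = card (induced H X \<union> induced H Y) + card (induced H (X \<inter> Y))"
    using card_Un_Int[OF finite_induced finite_induced, OF fin(2) fin(2), of X Y] by (simp add: induced_Int)
  have le': "card (induced H X \<union> induced H Y) \<le> card (induced H (X \<union> Y))"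
    using le finU by (rule card_mono[rotated])
  have "a * card X + a * card Y = a * card (X \<union> Y) + a * card (X \<inter> Y)"
    using card_Un_Int[OF finXY] by (simp flip: distrib_left)
  then have *: "card (induced H (X \<inter> Y)) + b = a * card (X \<inter> Y)"
    "card (induced H (X \<union> Y)) + b = a * card (X \<union> Y)"
    "card (induced H X \<union> induced H Y) = card (induced H (X \<union> Y))"
    using c le' U meet eqs by linarith+
  show "card (induced H (X \<inter> Y)) + b = a * card (X \<inter> Y)" by (fact *)
  show "tight V a b H (X \<union> Y)" using * sub c2 by (simp add: tight_def)
  show "induced H (X \<union> Y) = induced H X \<union> induced H Y"
    using card_subset_eq[OF finU le] *(3) by simp
qed

lemma card_swap: "finite H \<Longrightarrow> f \<in> H \<Longrightarrow> e \<notin> H \<Longrightarrow> card (insert e (H - {f})) = card H"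
  by (simp add: card_Suc_Diff1 del: card_Diff_insert)

lemma tight_swap:
  assumes "finite H" "e \<notin> H" "f \<in> H" "tight V a b H X" "induced H X \<subseteq> A" "e \<in> A" "e \<subseteq> X \<longleftrightarrow> f \<subseteq> X"
  shows "tight V a b (insert e (H - {f})) X \<and> induced (insert e (H - {f})) X \<subseteq> A"
proof (cases "e \<subseteq> X")
  case True
  then have eq: "induced (insert e (H - {f})) X = insert e (induced H X - {f})"
    and f: "f \<in> induced H X" and e: "e \<notin> induced H X"
    using assms by (auto simp: induced_def)
  have "card (induced (insert e (H - {f})) X) = card (induced H X)"
    unfolding eq using finite_induced[OF assms(1)] f e by (rule card_swap)
  then show ?thesis using assms unfolding tight_def eq by auto
next
  case False
  then have "induced (insert e (H - {f})) X = induced H X" using assms by (auto simp: induced_def)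
  then show ?thesis using assms by (simp add: tight_def)
qed

section \<open>Matroid union for two count matroids\<close>

locale packing =
  fixes V :: "'a set" and E :: "'a set set" and a b :: "bool \<Rightarrow> nat"
  assumes finV: "finite V" and edge: "\<And>e. e \<in> E \<Longrightarrow> e \<subseteq> V \<and> card e = 2" and ab: "\<And>i. b i < 2 * a i"
begin

lemma finE: "finite E"
  using finV edge by (intro finite_subset[of E "Pow V"]) auto

definition valid :: "(bool \<Rightarrow> 'a set set) \<Rightarrow> bool" where
  "valid S \<longleftrightarrow> (\<forall>i. S i \<subseteq> E \<and> sparse V (a i) (b i) (S i)) \<and> S True \<inter> S False = {}"

definition weight :: "(bool \<Rightarrow> 'a set set) \<Rightarrow> nat" where
  "weight S = card (S True) + card (S False)"

definition maximum :: "(bool \<Rightarrow> 'a set set) \<Rightarrow> bool" where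
  "maximum S \<longleftrightarrow> valid S \<and> (\<forall>S'. valid S' \<longrightarrow> weight S' \<le> weight S)"

text \<open>Maximality of both ends is part of the relation, which makes it symmetric; properties
  can thus be carried back to the starting pair.\<close>

definition step :: "(bool \<Rightarrow> 'a set set) \<Rightarrow> (bool \<Rightarrow> 'a set set) \<Rightarrow> bool" where
  "step S S' \<longleftrightarrow> maximum S \<and> maximum S' \<and>
    (\<exists>i e f. e \<in> E \<and> (\<forall>j. e \<notin> S j) \<and> f \<in> S i \<and> S' = S(i := insert e (S i - {f})))"

lemma finS: "valid S \<Longrightarrow> finite (S i)"
  using finE unfolding valid_def by (meson finite_subset)

lemma validI:
  assumes "valid S" "sparse V (a i) (b i) H" "H \<subseteq> E" "H \<inter> S (\<not> i) = {}"
  shows "valid (S(i := H))"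
  using assms unfolding valid_def by (cases i) (auto split: if_splits)

lemma weight_update:
  "weight (S(i := H)) + card (S i) = weight S + card H"
  by (cases i) (auto simp: weight_def)

lemma step_sym:
  assumes "step S S'"
  shows "step S' S"
proof -
  obtain i e f where *: "maximum S" "maximum S'" "e \<in> E" "\<forall>j. e \<notin> S j" "f \<in> S i"
    "S' = S(i := insert e (S i - {f}))"
    using assms unfolding step_def by blast
  have "f \<in> E" using * unfolding maximum_def valid_def by blast
  moreover have "f \<notin> S' j" for j
  proof (cases "j = i")
    case True
    then show ?thesis using * by auto
  next
    case False
    then have "S j \<inter> S i = {}" using *(1) unfolding maximum_def valid_def by (cases i; cases j) auto
    then show ?thesis using * False by auto
  qed
  moreover have "e \<in> S' i" using * by simp
  moreover have "S = S'(i := insert f (S' i - {e}))"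
    using * by (auto simp: fun_eq_iff)
  ultimately show ?thesis using *(1,2) unfolding step_def by blast
qed

text \<open>Adding the uncovered edge \<open>e\<close> to \<open>S i\<close> must violate a count,
  so some tight set contains \<open>e\<close>. Two such sets share the two ends of \<open>e\<close>,
  so they can be uncrossed and a smallest one exists. It cannot consist of these ends alone: it
  would have \<open>2 * a i - b i > 0\<close> edges, but \<open>e\<close> is not in
  \<open>S i\<close>.\<close>

lemma min_tight:
  assumes S: "maximum S" and e: "e \<in> E" "\<And>j. e \<notin> S j"
  obtains X where "tight V (a i) (b i) (S i) X" "e \<subseteq> X" "3 \<le> card X"
    "\<And>Y. tight V (a i) (b i) (S i) Y \<Longrightarrow> e \<subseteq> Y \<Longrightarrow> X \<subseteq> Y"
proof -
  have v: "valid S" using S by (simp add: maximum_def)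
  have sp: "sparse V (a i) (b i) (S i)" and SE: "S i \<subseteq> E" and dis: "S i \<inter> S (\<not> i) = {}"
    using v unfolding valid_def by (cases i; auto)+
  have fin: "finite (S i)" using v by (rule finS)
  have "\<not> sparse V (a i) (b i) (insert e (S i))"
  proof
    assume "sparse V (a i) (b i) (insert e (S i))"
    then have "valid (S(i := insert e (S i)))" using v SE e dis by (intro validI) auto
    then have "weight (S(i := insert e (S i))) \<le> weight S" using S by (simp add: maximum_def)
    then show False using weight_update[of S i "insert e (S i)"] e(2)[of i] fin by simp
  qed
  then obtain Y where Y: "Y \<subseteq> V" "2 \<le> card Y" "a i * card Y < card (induced (insert e (S i)) Y) + b i"
    unfolding sparse_def by (meson not_le)
  have le: "card (induced (S i) Y) + b i \<le> a i * card Y" using sparseD[OF sp Y(1,2)] .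
  have eY: "e \<subseteq> Y"
  proof (rule ccontr)
    assume "\<not> e \<subseteq> Y"
    then have "induced (insert e (S i)) Y = induced (S i) Y" by (auto simp: induced_def)
    then show False using le Y(3) by simp
  qed
  then have "induced (insert e (S i)) Y = insert e (induced (S i) Y)" by (auto simp: induced_def)
  then have "card (induced (insert e (S i)) Y) \<le> Suc (card (induced (S i) Y))"
    by (simp add: card_insert_le_m1 card_insert_if finite_induced fin)
  then have tY: "tight V (a i) (b i) (S i) Y" using Y le by (simp add: tight_def)
  define P where "P X \<longleftrightarrow> tight V (a i) (b i) (S i) X \<and> e \<subseteq> X" for X
  have "P Y" using tY eY by (simp add: P_def)
  then obtain X where X: "P X" and Xmin: "\<And>Z. P Z \<Longrightarrow> card X \<le> card Z"
    using ex_has_least_nat[of P Y card] by blast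
  have tX: "tight V (a i) (b i) (S i) X" and eX: "e \<subseteq> X" using X by (auto simp: P_def)
  have finX: "finite X" using tX finV by (auto simp: tight_def intro: finite_subset)
  show thesis
  proof (rule that[OF tX eX])
    show "3 \<le> card X"
    proof (rule ccontr)
      assume "\<not> 3 \<le> card X"
      moreover have "2 \<le> card X" using tX by (simp add: tight_def)
      ultimately have c2: "card X = 2" by simp
      then have "e = X" using card_subset_eq[OF finX eX] edge[OF e(1)] by simp
      have "f = e" if f: "f \<in> S i" "f \<subseteq> X" for f
      proof -
        have "card f = 2" using f SE edge by blast
        then show ?thesis using card_subset_eq[OF finX f(2)] c2 \<open>e = X\<close> by simp
      qed
      then have "induced (S i) X = {}" using e(2)[of i] by (auto simp: induced_def)
      then show False using tX ab[of i] c2 by (simp add: tight_def)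
    qed
    fix Z assume Z: "tight V (a i) (b i) (S i) Z" "e \<subseteq> Z"
    have "card e \<le> card (X \<inter> Z)" using eX Z(2) finX by (intro card_mono) auto
    then have c: "2 \<le> card (X \<inter> Z)" using edge[OF e(1)] by simp
    have sub: "X \<inter> Z \<subseteq> V" using tX by (auto simp: tight_def)
    have "card (induced (S i) (X \<inter> Z)) + b i = a i * card (X \<inter> Z)"
      by (rule tight_Int_Un(1)[OF finV fin sp tX Z(1) sparseD[OF sp sub c]])
    then have "P (X \<inter> Z)" using c sub eX Z(2) by (simp add: P_def tight_def)
    then have "card X \<le> card (X \<inter> Z)" by (rule Xmin)
    then have "X \<inter> Z = X" using finX card_seteq[of X "X \<inter> Z"] by blast
    then show "X \<subseteq> Z" by blast
  qed
qed

text \<open>The edges induced by the smallest tight set \<open>X\<close> together with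
  \<open>e\<close> form the fundamental circuit of \<open>e\<close>: every tight set that gains
  \<open>e\<close> contains \<open>X\<close> and therefore also loses \<open>f\<close>.\<close>

lemma swap_step:
  assumes S: "maximum S" and e: "e \<in> E" "\<And>j. e \<notin> S j"
    and X: "tight V (a i) (b i) (S i) X" "e \<subseteq> X"
      "\<And>Y. tight V (a i) (b i) (S i) Y \<Longrightarrow> e \<subseteq> Y \<Longrightarrow> X \<subseteq> Y"
    and f: "f \<in> induced (S i) X"
  shows "step S (S(i := insert e (S i - {f})))"
proof -
  let ?H = "insert e (S i - {f})"
  have v: "valid S" using S by (simp add: maximum_def)
  have sp: "sparse V (a i) (b i) (S i)" and SE: "S i \<subseteq> E" and dis: "S i \<inter> S (\<not> i) = {}"
    using v unfolding valid_def by (cases i; auto)+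
  have fin: "finite (S i)" using v by (rule finS)
  have fS: "f \<in> S i" "f \<subseteq> X" using f by (auto simp: induced_def)
  have "sparse V (a i) (b i) ?H"
    unfolding sparse_def
  proof (intro allI impI)
    fix Y assume Y: "Y \<subseteq> V" "2 \<le> card Y"
    have le: "card (induced (S i) Y) + b i \<le> a i * card Y" using sparseD[OF sp Y] .
    have finY: "finite (induced (S i) Y)" using fin by (rule finite_induced)
    show "card (induced ?H Y) + b i \<le> a i * card Y"
    proof (cases "e \<subseteq> Y")
      case False
      then have "induced ?H Y \<subseteq> induced (S i) Y" by (auto simp: induced_def)
      then have "card (induced ?H Y) \<le> card (induced (S i) Y)" by (rule card_mono[OF finY])
      then show ?thesis using le by simp
    next
      case eY: True
      show ?thesis
      proof (cases "tight V (a i) (b i) (S i) Y")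
        case True
        then have "X \<subseteq> Y" using X(3) eY by blast
        then have "tight V (a i) (b i) ?H Y"
          using tight_swap[OF fin e(2) fS(1) True subset_UNIV] eY fS(2) by blast
        then show ?thesis by (simp add: tight_def)
      next
        case False
        then have "card (induced (S i) Y) + b i < a i * card Y" using le Y by (simp add: tight_def)
        moreover have "induced ?H Y \<subseteq> insert e (induced (S i) Y)" by (auto simp: induced_def)
        then have "card (induced ?H Y) \<le> card (insert e (induced (S i) Y))"
          using finY by (intro card_mono) auto
        then have "card (induced ?H Y) \<le> Suc (card (induced (S i) Y))"
          using finY by (simp add: card_insert_if split: if_splits)
        ultimately show ?thesis by simp
      qed
    qed
  qed
  then have "valid (S(i := ?H))" using v SE e dis by (intro validI) auto
  moreover have "card ?H = card (S i)"
    using fin fS(1) e(2) by (rule card_swap)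
  then have "weight (S(i := ?H)) = weight S" using weight_update[of S i ?H] by simp
  ultimately have "maximum (S(i := ?H))" using S by (simp add: maximum_def)
  then show ?thesis using S e fS unfolding step_def by blast
qed

lemma exists_maximum: "\<exists>S. maximum S"
proof -
  have "sparse V (a i) (b i) {}" for i
  proof -
    have "b i \<le> a i * card X" if "2 \<le> card X" for X :: "'a set"
      using ab[of i] mult_le_mono2[OF that, of "a i"] by linarith
    then show ?thesis by (simp add: sparse_def induced_def)
  qed
  then have "valid (\<lambda>_. {})" by (simp add: valid_def)
  moreover have "weight S < Suc (card E + card E)" if v: "valid S" for S
  proof -
    have "card (S i) \<le> card E" for i using v finE unfolding valid_def by (meson card_mono)
    from this[of True] this[of False] show ?thesis by (simp add: weight_def)
  qed
  ultimately show ?thesis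
    using ex_has_greatest_nat[of valid "\<lambda>_. {}" weight "Suc (card E + card E)"] unfolding maximum_def by blast
qed

text \<open>The set \<open>A\<close> collects the edges that are uncovered after some sequence of swaps. The closure of
  each part inside \<open>A\<close> does not change under a swap, so no shortest augmenting path is needed.\<close>

lemma partition_tight:
  obtains S A where "valid S" "E - A \<subseteq> S True \<union> S False" "A \<subseteq> E"
    "\<And>i e. e \<in> A \<Longrightarrow> \<exists>X. tight V (a i) (b i) (S i) X \<and> e \<subseteq> X \<and> 3 \<le> card X \<and> induced (S i) X \<subseteq> A"
proof -
  obtain S0 where S0: "maximum S0" using exists_maximum by blast
  define A where "A = {e \<in> E. \<exists>S. step\<^sup>*\<^sup>* S0 S \<and> (\<forall>j. e \<notin> S j)}"
  have max: "maximum S" if "step\<^sup>*\<^sup>* S0 S" for S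
    using that S0 by (cases rule: rtranclp.cases) (auto simp: step_def)
  define Q where "Q S i e \<longleftrightarrow> (\<exists>X. tight V (a i) (b i) (S i) X \<and> e \<subseteq> X \<and> 3 \<le> card X \<and> induced (S i) X \<subseteq> A)" for S i e
  \<comment> \<open>Any edge on the circuit of an uncovered edge can itself be uncovered by one more
    swap.\<close>
  have uncov: "induced (S i) X \<subseteq> A"
    if S: "step\<^sup>*\<^sup>* S0 S" and e: "e \<in> E" "\<And>j. e \<notin> S j"
      and X: "tight V (a i) (b i) (S i) X" "e \<subseteq> X"
        "\<And>Y. tight V (a i) (b i) (S i) Y \<Longrightarrow> e \<subseteq> Y \<Longrightarrow> X \<subseteq> Y" for S i e X
  proof
    fix f assume f: "f \<in> induced (S i) X"
    let ?S = "S(i := insert e (S i - {f}))"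
    have st: "step S ?S" by (rule swap_step[OF max[OF S] e X f])
    then have r: "step\<^sup>*\<^sup>* S0 ?S" using S by simp
    have v: "valid S" using max[OF S] by (simp add: maximum_def)
    have fS: "f \<in> S i" using f by (simp add: induced_def)
    have "f \<notin> ?S j" for j
    proof (cases "j = i")
      case True
      then show ?thesis using e(2)[of i] fS by auto
    next
      case False
      then have "S j \<inter> S i = {}" using v unfolding valid_def by (cases i; cases j) auto
      then show ?thesis using fS False by auto
    qed
    moreover have "f \<in> E" using fS v unfolding valid_def by blast
    ultimately show "f \<in> A" using r unfolding A_def by blast
  qed
  have transport: "Q S' i g" if S: "step\<^sup>*\<^sup>* S0 S" and st: "step S S'" and q: "Q S i g" for S S' i g
  proof -
    obtain j e f where *: "e \<in> E" "\<And>j. e \<notin> S j" "f \<in> S j" "S' = S(j := insert e (S j - {f}))"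
      and m': "maximum S'" using st unfolding step_def by blast
    obtain Xg where Xg: "tight V (a i) (b i) (S i) Xg" "g \<subseteq> Xg" "3 \<le> card Xg" "induced (S i) Xg \<subseteq> A"
      using q unfolding Q_def by blast
    show ?thesis
    proof (cases "j = i")
      case False
      then show ?thesis using q *(4) unfolding Q_def by auto
    next
      case True
      have f: "f \<in> S i" and S': "S' i = insert e (S i - {f})" using *(3,4) True by auto
      have v: "valid S" using max[OF S] by (simp add: maximum_def)
      have sp: "sparse V (a i) (b i) (S i)" and SE: "S i \<subseteq> E" using v unfolding valid_def by blast+
      have sp': "sparse V (a i) (b i) (S' i)" using m' unfolding maximum_def valid_def by blast
      have fin: "finite (S i)" using v by (rule finS)
      have eA: "e \<in> A" using S * unfolding A_def by blast
      obtain X where X: "tight V (a i) (b i) (S i) X" "e \<subseteq> X" "3 \<le> card X"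
        "\<And>Y. tight V (a i) (b i) (S i) Y \<Longrightarrow> e \<subseteq> Y \<Longrightarrow> X \<subseteq> Y"
        using min_tight[OF max[OF S] *(1,2), of i] by blast
      have XA: "induced (S i) X \<subseteq> A" by (rule uncov[OF S *(1,2) X(1,2,4)])
      \<comment> \<open>Otherwise the swap would put one edge too many into the tight set
        \<open>X\<close>.\<close>
      have fX: "f \<subseteq> X"
      proof (rule ccontr)
        assume "\<not> f \<subseteq> X"
        then have "induced (S' i) X = insert e (induced (S i) X)"
          using X(2) unfolding S' by (auto simp: induced_def)
        moreover have "e \<notin> induced (S i) X" using *(2)[of i] by (simp add: induced_def)
        ultimately have "card (induced (S' i) X) = Suc (card (induced (S i) X))"
          using finite_induced[OF fin] by simp
        then show False using sparseD[OF sp', of X] X(1) by (simp add: tight_def)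
      qed
      show ?thesis
      proof (cases "e \<subseteq> Xg \<longleftrightarrow> f \<subseteq> Xg")
        case True
        from tight_swap[OF fin *(2) f Xg(1,4) eA True] show ?thesis
          using Xg(2,3) unfolding Q_def S' by blast
      next
        case False
        \<comment> \<open>Here \<open>Xg\<close> loses \<open>f\<close> without gaining
          \<open>e\<close> and is no longer tight. Its union with \<open>X\<close> contains both
          edges, is tight by uncrossing, and induces only edges of \<open>A\<close>.\<close>
        have "\<not> e \<subseteq> Xg"
        proof
          assume "e \<subseteq> Xg"
          then have "X \<subseteq> Xg" using X(4) Xg(1) by blast
          then show False using False \<open>e \<subseteq> Xg\<close> fX by blast
        qed
        then have fXg: "f \<subseteq> Xg" using False by blast
        have finX: "finite X" "finite Xg" using X(1) Xg(1) finV by (auto simp: tight_def intro: finite_subset)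
        have "card f \<le> card (Xg \<inter> X)" using fX fXg finX by (intro card_mono) auto
        then have c: "2 \<le> card (Xg \<inter> X)" using edge[of f] f SE by auto
        have sub: "Xg \<inter> X \<subseteq> V" using X(1) by (auto simp: tight_def)
        note un = tight_Int_Un[OF finV fin sp Xg(1) X(1) sparseD[OF sp sub c]]
        have "induced (S i) (Xg \<union> X) \<subseteq> A" using un(3) XA Xg(4) by simp
        from tight_swap[OF fin *(2) f un(2) this eA]
        have "tight V (a i) (b i) (S' i) (Xg \<union> X) \<and> induced (S' i) (Xg \<union> X) \<subseteq> A"
          using fX X(2) unfolding S' by blast
        moreover have "card X \<le> card (Xg \<union> X)" using finX by (intro card_mono) auto
        ultimately show ?thesis using X(3) Xg(2) unfolding Q_def by (meson le_supI1 order_trans)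
      qed
    qed
  qed
  \<comment> \<open>Each \<open>e\<close> of \<open>A\<close> has a tight set at the stage where it
    is uncovered; walking the swaps backwards provides one for the single pair
    \<open>S0\<close>.\<close>
  have to_start: "Q S0 i e" if "step\<^sup>*\<^sup>* S0 S" "Q S i e" for S i e
    using that
  proof (induction rule: rtranclp_induct)
    case (step S S')
    then have "Q S i e" using transport[of S' S i e] step_sym by (meson rtranclp.rtrancl_into_rtrancl)
    then show ?case by (rule step.IH)
  qed simp
  show thesis
  proof (rule that[of S0 A])
    show "valid S0" using S0 by (simp add: maximum_def)
    show "A \<subseteq> E" by (auto simp: A_def)
    show "E - A \<subseteq> S0 True \<union> S0 False"
    proof
      fix e assume "e \<in> E - A"
      then have "\<exists>j. e \<in> S0 j" unfolding A_def by blast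
      then show "e \<in> S0 True \<union> S0 False" by (metis (full_types) UnCI)
    qed
    fix i e assume "e \<in> A"
    then obtain S where S: "step\<^sup>*\<^sup>* S0 S" and e: "e \<in> E" "\<And>j. e \<notin> S j" unfolding A_def by blast
    obtain X where X: "tight V (a i) (b i) (S i) X" "e \<subseteq> X" "3 \<le> card X"
      "\<And>Y. tight V (a i) (b i) (S i) Y \<Longrightarrow> e \<subseteq> Y \<Longrightarrow> X \<subseteq> Y"
      using min_tight[OF max[OF S] e, of i] by blast
    have "Q S i e" using X uncov[OF S e X(1,2,4)] unfolding Q_def by blast
    then have "Q S0 i e" using to_start S by blast
    then show "\<exists>X. tight V (a i) (b i) (S0 i) X \<and> e \<subseteq> X \<and> 3 \<le> card X \<and> induced (S0 i) X \<subseteq> A"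
      by (simp add: Q_def)
  qed
qed

end

section \<open>Maximal tight sets and edge counts\<close>

lemma maximal_tight_sets:
  assumes fin: "finite V" "finite H" and sp: "sparse V a b H"
    and cov: "\<And>e. e \<in> A \<Longrightarrow> \<exists>X. tight V a b H X \<and> e \<subseteq> X \<and> 3 \<le> card X \<and> induced H X \<subseteq> A"
  obtains C where "finite C" "\<And>X. X \<in> C \<Longrightarrow> tight V a b H X \<and> 3 \<le> card X \<and> induced H X \<subseteq> A"
    "\<And>e. e \<in> A \<Longrightarrow> \<exists>X\<in>C. e \<subseteq> X"
    "\<And>X Y. X \<in> C \<Longrightarrow> Y \<in> C \<Longrightarrow> X \<noteq> Y \<Longrightarrow> a * card (X \<inter> Y) < card (induced H (X \<inter> Y)) + b"
proof -
  define good where "good X \<longleftrightarrow> tight V a b H X \<and> 3 \<le> card X \<and> induced H X \<subseteq> A" for X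
  \<comment> \<open>If the intersection of two maximal sets satisfied the sparsity count, their
    union would be tight as well. The negated count is kept as it stands, since it excludes one
    common vertex for forests but only two for \<open>H\<close>.\<close>
  define C where "C = {X. good X \<and> (\<forall>Y. good Y \<longrightarrow> X \<subseteq> Y \<longrightarrow> Y = X)}"
  have sub: "X \<subseteq> V" if "good X" for X using that by (simp add: good_def tight_def)
  have above: "\<exists>Y\<in>C. X \<subseteq> Y" if X: "good X" for X
  proof -
    have "card Y < Suc (card V)" if "good Y \<and> X \<subseteq> Y" for Y
      using card_mono[OF fin(1) sub[of Y]] that by simp
    then obtain Y where Y: "good Y \<and> X \<subseteq> Y" and Ymax: "\<And>Z. good Z \<and> X \<subseteq> Z \<Longrightarrow> card Z \<le> card Y"
      using ex_has_greatest_nat[of "\<lambda>Y. good Y \<and> X \<subseteq> Y" X card "Suc (card V)"] X by blast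
    have "Z = Y" if Z: "good Z" "Y \<subseteq> Z" for Z
    proof -
      have "card Z \<le> card Y" using Ymax Y Z by blast
      moreover have "finite Z" using sub[OF Z(1)] fin(1) by (rule finite_subset)
      ultimately show ?thesis using card_seteq[of Z Y] Z(2) by blast
    qed
    then show ?thesis using Y unfolding C_def by blast
  qed
  show thesis
  proof (rule that[of C])
    show "finite C" by (rule finite_subset[of _ "Pow V"]) (use sub fin in \<open>auto simp: C_def\<close>)
    show "tight V a b H X \<and> 3 \<le> card X \<and> induced H X \<subseteq> A" if "X \<in> C" for X
      using that by (simp add: C_def good_def)
    show "\<exists>X\<in>C. e \<subseteq> X" if e: "e \<in> A" for e
    proof -
      obtain X where "good X" "e \<subseteq> X" using cov[OF e] unfolding good_def by blast
      then show ?thesis using above[of X] by blast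
    qed
    fix X Y assume XY: "X \<in> C" "Y \<in> C" "X \<noteq> Y"
    then have g: "good X" "good Y" by (auto simp: C_def)
    show "a * card (X \<inter> Y) < card (induced H (X \<inter> Y)) + b"
    proof (rule ccontr)
      assume "\<not> ?thesis"
      then have le: "card (induced H (X \<inter> Y)) + b \<le> a * card (X \<inter> Y)" by simp
      have t: "tight V a b H X" "tight V a b H Y" using g by (auto simp: good_def)
      note un = tight_Int_Un[OF fin sp t le]
      have "finite (X \<union> Y)" using sub[OF g(1)] sub[OF g(2)] fin(1) by (auto intro: finite_subset)
      then have "card X \<le> card (X \<union> Y)" by (intro card_mono) auto
      then have "good (X \<union> Y)" using un g unfolding good_def by auto
      then have "X \<union> Y = X" "X \<union> Y = Y" using XY(1,2) unfolding C_def by blast+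
      then show False using XY(3) by blast
    qed
  qed
qed

text \<open>The sets \<open>induced H X\<close> partition \<open>H \<inter> A\<close>: an edge of
  \<open>A\<close> lies in some member, and two members share at most one vertex, hence no
  edge.\<close>

lemma card_tight_family:
  assumes "finite H" "finite C" and edge: "\<And>e. e \<in> H \<Longrightarrow> card e = 2" and finX: "\<And>X. X \<in> C \<Longrightarrow> finite X"
    and t: "\<And>X. X \<in> C \<Longrightarrow> tight V a b H X \<and> induced H X \<subseteq> A"
    and cov: "\<And>e. e \<in> A \<Longrightarrow> \<exists>X\<in>C. e \<subseteq> X"
    and meet: "\<And>X Y. X \<in> C \<Longrightarrow> Y \<in> C \<Longrightarrow> X \<noteq> Y \<Longrightarrow> card (X \<inter> Y) < 2"
  shows "card (H \<inter> A) + b * card C = a * (\<Sum>X\<in>C. card X)"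
proof -
  have "H \<inter> A = (\<Union>X\<in>C. induced H X)"
    using t cov by (fastforce simp: induced_def)
  moreover have "card (\<Union>X\<in>C. induced H X) = (\<Sum>X\<in>C. card (induced H X))"
  proof (rule card_UN_disjoint[OF assms(2)])
    show "\<forall>X\<in>C. finite (induced H X)" using assms(1) by (simp add: finite_induced)
    show "\<forall>X\<in>C. \<forall>Y\<in>C. X \<noteq> Y \<longrightarrow> induced H X \<inter> induced H Y = {}"
    proof (intro ballI impI)
      fix X Y assume XY: "X \<in> C" "Y \<in> C" "X \<noteq> Y"
      have "e \<notin> induced H (X \<inter> Y)" for e
      proof
        assume "e \<in> induced H (X \<inter> Y)"
        then have e: "e \<in> H" "e \<subseteq> X \<inter> Y" by (auto simp: induced_def)
        have "card e \<le> card (X \<inter> Y)" using finX[OF XY(1)] e(2) by (intro card_mono) auto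
        then show False using meet[OF XY] edge[OF e(1)] by simp
      qed
      then show "induced H X \<inter> induced H Y = {}" by (auto simp: induced_Int)
    qed
  qed
  ultimately have "card (H \<inter> A) + b * card C = (\<Sum>X\<in>C. card (induced H X) + b)"
    by (simp add: sum.distrib)
  also have "\<dots> = (\<Sum>X\<in>C. a * card X)" using t by (intro sum.cong) (auto simp: tight_def)
  finally show ?thesis by (simp add: sum_distrib_left)
qed

text \<open>If no edge crossed \<open>P\<close>, the two sides would have at most
  \<open>a |P| - b\<close> and strictly fewer than \<open>a |X - P|\<close> edges. The strict bound
  on the second side holds for a single vertex too.\<close>

lemma tight_connected:
  assumes finV: "finite V" and fin: "finite H" and sp: "sparse V a b H" and edge: "\<And>e. e \<in> H \<Longrightarrow> card e = 2"
    and X: "tight V a b H X" and P: "P \<subset> X" "2 \<le> card P" and a: "0 < a" and b: "0 < b"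
  obtains e where "e \<in> induced H X" "crosses P e"
proof -
  have "\<exists>e\<in>induced H X. crosses P e"
  proof (rule ccontr)
    assume no: "\<not> ?thesis"
    let ?Q = "X - P"
    have XV: "X \<subseteq> V" and Xeq: "card (induced H X) + b = a * card X" using X by (auto simp: tight_def)
    have finX: "finite X" using XV finV by (rule finite_subset)
    have "e \<subseteq> P \<or> e \<subseteq> ?Q" if e: "e \<in> induced H X" for e
    proof -
      have "e \<subseteq> X" using e by (simp add: induced_def)
      then show ?thesis using no e unfolding crosses_def by blast
    qed
    then have "induced H X \<subseteq> induced H P \<union> induced H ?Q" by (auto simp: induced_def)
    then have "card (induced H X) \<le> card (induced H P \<union> induced H ?Q)"
      using finite_induced[OF fin] by (intro card_mono) auto
    also have "\<dots> \<le> card (induced H P) + card (induced H ?Q)" by (rule card_Un_le)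
    finally have c1: "card (induced H X) \<le> card (induced H P) + card (induced H ?Q)" .
    have c2: "card (induced H P) + b \<le> a * card P" using sparseD[OF sp _ P(2)] P(1) XV by blast
    have "card X = card P + card ?Q" using P(1) finX by (metis card_Un_disjoint Diff_disjoint Diff_partition psubset_imp_subset finite_subset finite_Diff)
    then have c3: "a * card X = a * card P + a * card ?Q" by (simp add: distrib_left)
    have "card (induced H ?Q) < a * card ?Q"
    proof (cases "2 \<le> card ?Q")
      case True
      then have "card (induced H ?Q) + b \<le> a * card ?Q" using sparseD[OF sp, of ?Q] XV by blast
      then show ?thesis using b by simp
    next
      case False
      have "card e \<le> card ?Q" if "e \<in> induced H ?Q" for e
        using that finX by (intro card_mono) (auto simp: induced_def)
      then have "induced H ?Q = {}" using False edge unfolding induced_def by fastforce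
      moreover have "0 < card ?Q" using P(1) finX by (auto simp: card_gt_0_iff)
      ultimately show ?thesis using a by simp
    qed
    then show False using c1 c2 c3 Xeq by linarith
  qed
  then show thesis using that by blast
qed

text \<open>Every vertex in \<open>t\<close> members of \<open>C\<close> is charged \<open>t - 1\<close> times. A member with \<open>B\<close> the set of its
  vertices lying in further members gains \<open>a |B| / 2\<close> from these and at least \<open>(4 a - a |B|) / 2\<close>
  from the uncovered edges leaving its private part.\<close>

lemma weakly_connected_charging:
  fixes V :: "'a set" and a b :: nat
  assumes finV: "finite V" and edge: "\<And>e. e \<in> E \<Longrightarrow> e \<subseteq> V \<and> card e = 2" and V2: "2 \<le> card V"
    and a: "1 \<le> a" and b: "b + 1 = 2 * a"
    and weak: "\<And>A B. A \<inter> B = {} \<Longrightarrow> A \<noteq> {} \<Longrightarrow> A \<union> B \<subset> V \<Longrightarrow>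
      4 * a \<le> card {e \<in> E. crosses A e \<and> e \<inter> B = {}} + a * card B"
    and finC: "finite C" and C: "\<And>X. X \<in> C \<Longrightarrow> X \<subset> V \<and> 4 \<le> card X"
    and cov: "\<And>e. e \<in> A \<Longrightarrow> \<exists>X\<in>C. e \<subseteq> X"
  shows "a * card V + card C + card (V - \<Union>C) + b * card C \<le> a * (\<Sum>X\<in>C. card X) + card (E - A)"
proof -
  define t where "t v = card {X \<in> C. v \<in> X}" for v
  define B where "B X = {v \<in> X. 2 \<le> t v}" for X
  define P where "P X = {v \<in> X. t v < 2}" for X
  define d where "d X = card {e \<in> E. crosses (P X) e \<and> e \<inter> B X = {}}" for X
  define I where "I = V - \<Union>C"
  define g where "g x = card {e \<in> E - A. x \<in> e}" for x
  have finE: "finite E" by (rule finite_subset[of _ "Pow V"]) (use edge finV in auto)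
  have finX: "finite X" if "X \<in> C" for X using C[OF that] finV by (meson finite_subset psubset_imp_subset)
  have t0: "t v = 0 \<longleftrightarrow> v \<notin> \<Union>C" for v using finC by (auto simp: t_def)
  have uniq: "X = Y" if "v \<in> X" "v \<in> Y" "X \<in> C" "Y \<in> C" "t v < 2" for v X Y
  proof (rule ccontr)
    assume "X \<noteq> Y"
    have "card {X, Y} \<le> t v" unfolding t_def using finC that by (intro card_mono) auto
    then show False using \<open>X \<noteq> Y\<close> that(5) by simp
  qed
  have sum1: "(\<Sum>X\<in>C. card {v \<in> X. Q v}) = (\<Sum>v\<in>V. if Q v then t v else 0)" for Q
  proof -
    have "card {v \<in> X. Q v} = (\<Sum>v\<in>V. if Q v \<and> v \<in> X then 1 else 0)" if "X \<in> C" for X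
    proof -
      have "{v \<in> X. Q v} = {v \<in> V. Q v \<and> v \<in> X}" using C[OF that] by auto
      then show ?thesis using finV by (simp add: sum.If_cases Int_def)
    qed
    then have "(\<Sum>X\<in>C. card {v \<in> X. Q v}) = (\<Sum>X\<in>C. \<Sum>v\<in>V. if Q v \<and> v \<in> X then 1 else 0)" by simp
    also have "\<dots> = (\<Sum>v\<in>V. \<Sum>X\<in>C. if Q v \<and> v \<in> X then 1 else 0)" by (rule sum.swap)
    also have "\<dots> = (\<Sum>v\<in>V. if Q v then t v else 0)"
      using finC by (intro sum.cong) (auto simp: t_def sum.If_cases Int_def)
    finally show ?thesis .
  qed
  have S1: "(\<Sum>X\<in>C. card X) = (\<Sum>v\<in>V. t v)" using sum1[of "\<lambda>_. True"] by simp
  have S2: "(\<Sum>X\<in>C. card (B X)) = (\<Sum>v\<in>V. if 2 \<le> t v then t v else 0)"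
    unfolding B_def by (rule sum1)
  have "I = {v \<in> V. t v = 0}" unfolding I_def using t0 by auto
  then have cI: "card I = (\<Sum>v\<in>V. if t v = 0 then 1 else 0)" using finV by (simp add: sum.If_cases Int_def)
  \<comment> \<open>Termwise this is equality for \<open>t v = 0\<close> and \<open>t v = 1\<close>,
    and \<open>2 + t v \<le> 2 * t v\<close> from two on.\<close>
  have "(\<Sum>v\<in>V. 2 + (if 2 \<le> t v then t v else 0)) \<le> (\<Sum>v\<in>V. 2 * t v + 2 * (if t v = 0 then 1 else 0))"
    by (rule sum_mono) auto
  then have S3: "2 * card V + (\<Sum>X\<in>C. card (B X)) \<le> 2 * (\<Sum>X\<in>C. card X) + 2 * card I"
    unfolding S1 S2 cI
    by (simp only: sum.distrib flip: sum_distrib_left) (simp only: sum_constant of_nat_id mult.commute)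
  \<comment> \<open>The hypothesis is applied to the private part with the shared vertices deleted.
    A member without private part has at least four shared vertices, which is why
    \<open>4 \<le> card X\<close> is required.\<close>
  have dX: "4 * a \<le> d X + a * card (B X)" if X: "X \<in> C" for X
  proof (cases "P X = {}")
    case True
    then have "B X = X" unfolding P_def B_def by (auto simp: not_less)
    then have "4 \<le> card (B X)" using C[OF X] by simp
    then have "a * 4 \<le> a * card (B X)" by (rule mult_le_mono2)
    then show ?thesis by linarith
  next
    case False
    have "P X \<union> B X = X" "P X \<inter> B X = {}" unfolding P_def B_def by auto
    then show ?thesis using weak[of "P X" "B X"] False C[OF X] unfolding d_def by simp
  qed
  have g1: "4 * a \<le> g v" if v: "v \<in> I" for v
  proof -
    have "{v} \<noteq> V" using V2 by auto
    then have "{v} \<subset> V" using v unfolding I_def by blast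
    then have "4 * a \<le> card {e \<in> E. crosses {v} e}" using weak[of "{v}" "{}"] by simp
    also have "\<dots> \<le> g v"
      unfolding g_def
    proof (rule card_mono)
      show "finite {e \<in> E - A. v \<in> e}" using finE by simp
      have "e \<notin> A" if "v \<in> e" for e using cov[of e] v that unfolding I_def by blast
      then show "{e \<in> E. crosses {v} e} \<subseteq> {e \<in> E - A. v \<in> e}" by (auto simp: crosses_def)
    qed
    finally show ?thesis .
  qed
  \<comment> \<open>An edge leaving the private part and avoiding \<open>B X\<close> leaves
    \<open>X\<close>. It is not in \<open>A\<close>: a member containing it would contain its
    private end and thus be \<open>X\<close>.\<close>
  have g2: "d X \<le> (\<Sum>x\<in>P X. g x)" if X: "X \<in> C" for X
  proof -
    have "{e \<in> E. crosses (P X) e \<and> e \<inter> B X = {}} \<subseteq> (\<Union>x\<in>P X. {e \<in> E - A. x \<in> e})"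
    proof
      fix e assume "e \<in> {e \<in> E. crosses (P X) e \<and> e \<inter> B X = {}}"
      then have e: "e \<in> E" "crosses (P X) e" "e \<inter> B X = {}" by auto
      then obtain x where x: "x \<in> e" "x \<in> P X" by (auto simp: crosses_def)
      have "X = P X \<union> B X" unfolding P_def B_def by auto
      then have nX: "\<not> e \<subseteq> X" using e(2,3) unfolding crosses_def by blast
      have "e \<notin> A"
      proof
        assume "e \<in> A"
        then obtain Y where Y: "Y \<in> C" "e \<subseteq> Y" using cov by blast
        then have "X = Y" using uniq[of x X Y] x X unfolding P_def by blast
        then show False using nX Y by blast
      qed
      then show "e \<in> (\<Union>x\<in>P X. {e \<in> E - A. x \<in> e})" using e x by blast
    qed
    moreover have finP: "finite (P X)" using finX[OF X] by (simp add: P_def)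
    ultimately have "d X \<le> card (\<Union>x\<in>P X. {e \<in> E - A. x \<in> e})"
      unfolding d_def using finE by (intro card_mono) auto
    also have "\<dots> \<le> (\<Sum>x\<in>P X. g x)" unfolding g_def by (rule card_UN_le[OF finP])
    finally show ?thesis .
  qed
  have "(\<Sum>X\<in>C. \<Sum>x\<in>P X. g x) = (\<Sum>x\<in>(\<Union>X\<in>C. P X). g x)"
    using finC finX uniq by (intro sum.UNION_disjoint[symmetric]) (auto simp: P_def)
  moreover have "(\<Sum>x\<in>(\<Union>X\<in>C. P X). g x) + (\<Sum>x\<in>I. g x) = (\<Sum>x\<in>(\<Union>X\<in>C. P X) \<union> I. g x)"
    using finC finX finV by (intro sum.union_disjoint[symmetric]) (auto simp: P_def I_def)
  moreover have "(\<Sum>x\<in>(\<Union>X\<in>C. P X) \<union> I. g x) \<le> (\<Sum>x\<in>V. g x)"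
    using finV C by (intro sum_mono2) (auto simp: P_def I_def)
  moreover have "(\<Sum>x\<in>V. g x) = 2 * card (E - A)"
  proof -
    have "(\<Sum>x\<in>V. g x) = (\<Sum>x\<in>V. \<Sum>e\<in>E - A. if x \<in> e then 1 else 0)"
      unfolding g_def using finE by (simp add: sum.If_cases Int_def)
    also have "\<dots> = (\<Sum>e\<in>E - A. \<Sum>x\<in>V. if x \<in> e then 1 else 0)" by (rule sum.swap)
    also have "\<dots> = (\<Sum>e\<in>E - A. 2)"
    proof (rule sum.cong[OF refl])
      fix e assume "e \<in> E - A"
      then have "e \<subseteq> V" "card e = 2" using edge by auto
      then show "(\<Sum>x\<in>V. if x \<in> e then 1 else 0) = (2::nat)" using finV by (simp add: sum.If_cases Int_absorb1)
    qed
    finally show ?thesis by simp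
  qed
  moreover have "(\<Sum>X\<in>C. d X) \<le> (\<Sum>X\<in>C. \<Sum>x\<in>P X. g x)" using g2 by (rule sum_mono)
  moreover have "card I * (4 * a) \<le> (\<Sum>x\<in>I. g x)" using sum_bounded_below[of I "4 * a" g] g1 by simp
  ultimately have S4: "(\<Sum>X\<in>C. d X) + card I * (4 * a) \<le> 2 * card (E - A)" by linarith
  have "(\<Sum>X\<in>C. 4 * a) \<le> (\<Sum>X\<in>C. d X + a * card (B X))" using dX by (rule sum_mono)
  then have S5: "card C * (4 * a) \<le> (\<Sum>X\<in>C. d X) + a * (\<Sum>X\<in>C. card (B X))"
    by (simp add: sum.distrib sum_distrib_left)
  have S3': "2 * (a * card V) + a * (\<Sum>X\<in>C. card (B X)) \<le> 2 * (a * (\<Sum>X\<in>C. card X)) + 2 * (a * card I)"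
    using mult_le_mono2[OF S3, of a] by (simp add: distrib_left mult.left_commute)
  \<comment> \<open>From \<open>4 * a = 2 * (b + 1)\<close>: this yields the extra
    \<open>card C\<close> of the claim, while half of \<open>4 * a\<close> per uncovered vertex
    remains after \<open>S3'\<close> for \<open>card I\<close>. All inequalities are
    doubled.\<close>
  have "card C * (4 * a) = 2 * card C + 2 * (b * card C)"
    using arg_cong[OF b, of "\<lambda>x. 2 * (x * card C)"] by (simp add: algebra_simps)
  moreover have "card I * (4 * a) = 4 * (a * card I)" by simp
  moreover have "card I \<le> a * card I" using a by simp
  ultimately show ?thesis using S3' S4 S5 unfolding I_def[symmetric] by linarith
qed

text \<open>If \<open>V\<close> were not a maximal tight set of \<open>H\<close>, the charging bound
  would give \<open>card H + card F \<ge> (a + 1) * card V\<close>, more than sparsity allows. So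
  \<open>V\<close> is tight for \<open>H\<close>, and the sets of the tree part are unions of
  overlapping or larger regions containing those of \<open>H\<close>, hence \<open>V\<close> is
  tight there too.\<close>

theorem tight_and_tree_packing:
  fixes V :: "'a set" and a b :: nat
  assumes finV: "finite V" and edge: "\<And>e. e \<in> E \<Longrightarrow> e \<subseteq> V \<and> card e = 2" and V2: "2 \<le> card V"
    and a: "3 \<le> a" and b: "b + 1 = 2 * a"
    and weak: "\<And>A B. A \<inter> B = {} \<Longrightarrow> A \<noteq> {} \<Longrightarrow> A \<union> B \<subset> V \<Longrightarrow>
      4 * a \<le> card {e \<in> E. crosses A e \<and> e \<inter> B = {}} + a * card B"
  obtains H F where "H \<subseteq> E" "F \<subseteq> E" "H \<inter> F = {}" "sparse V a b H" "tight V a b H V"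
    "sparse V 1 1 F" "tight V 1 1 F V"
proof -
  interpret packing V E "\<lambda>i. if i then a else 1" "\<lambda>i. if i then b else 1"
    using finV edge a b by unfold_locales auto
  obtain S A where v: "valid S" and EA: "E - A \<subseteq> S True \<union> S False" and AE: "A \<subseteq> E"
    and tA: "\<And>i e. e \<in> A \<Longrightarrow> \<exists>X. tight V (if i then a else 1) (if i then b else 1) (S i) X
      \<and> e \<subseteq> X \<and> 3 \<le> card X \<and> induced (S i) X \<subseteq> A"
    using partition_tight by blast
  define H where "H = S True"
  define F where "F = S False"
  have HE: "H \<subseteq> E" and FE: "F \<subseteq> E" and spH: "sparse V a b H" and spF: "sparse V 1 1 F" and dis: "H \<inter> F = {}"
    using v unfolding valid_def H_def F_def by (auto dest: spec[of _ True] spec[of _ False])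
  have finH: "finite H" and finF: "finite F" using HE FE finE by (auto intro: finite_subset)
  have tH: "\<exists>X. tight V a b H X \<and> e \<subseteq> X \<and> 3 \<le> card X \<and> induced H X \<subseteq> A" if "e \<in> A" for e
    using tA[OF that, of True] by (simp add: H_def)
  have tF: "\<exists>X. tight V 1 1 F X \<and> e \<subseteq> X \<and> 3 \<le> card X \<and> induced F X \<subseteq> A" if "e \<in> A" for e
    using tA[OF that, of False] by (simp add: F_def)
  obtain C where finC: "finite C" and C: "\<And>X. X \<in> C \<Longrightarrow> tight V a b H X \<and> 3 \<le> card X \<and> induced H X \<subseteq> A"
    and covC: "\<And>e. e \<in> A \<Longrightarrow> \<exists>X\<in>C. e \<subseteq> X"
    and meetC: "\<And>X Y. X \<in> C \<Longrightarrow> Y \<in> C \<Longrightarrow> X \<noteq> Y \<Longrightarrow> a * card (X \<inter> Y) < card (induced H (X \<inter> Y)) + b"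
    using maximal_tight_sets[OF finV finH spH tH] by blast
  obtain T where finT: "finite T" and T: "\<And>X. X \<in> T \<Longrightarrow> tight V 1 1 F X \<and> 3 \<le> card X \<and> induced F X \<subseteq> A"
    and covT: "\<And>e. e \<in> A \<Longrightarrow> \<exists>X\<in>T. e \<subseteq> X"
    and meetT: "\<And>X Y. X \<in> T \<Longrightarrow> Y \<in> T \<Longrightarrow> X \<noteq> Y \<Longrightarrow> 1 * card (X \<inter> Y) < card (induced F (X \<inter> Y)) + 1"
    using maximal_tight_sets[OF finV finF spF tF] by blast
  have subC: "X \<subseteq> V" if "X \<in> C" for X using C[OF that] by (simp add: tight_def)
  have subT: "X \<subseteq> V" if "X \<in> T" for X using T[OF that] by (simp add: tight_def)
  have finX: "finite X" if "X \<in> C" for X using subC[OF that] finV by (rule finite_subset)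
  have finY: "finite X" if "X \<in> T" for X using subT[OF that] finV by (rule finite_subset)
  have edgeH: "card e = 2" if "e \<in> H" for e using that HE edge by blast
  have edgeF: "card e = 2" if "e \<in> F" for e using that FE edge by blast
  \<comment> \<open>For \<open>a = b = 1\<close> the sparsity count also holds on one vertex, so
    maximal sets of the forest do not even share a vertex.\<close>
  have disT: "X \<inter> Y = {}" if XY: "X \<in> T" "Y \<in> T" "X \<noteq> Y" for X Y
  proof (rule ccontr)
    assume ne: "X \<inter> Y \<noteq> {}"
    have sub: "X \<inter> Y \<subseteq> V" and finI: "finite (X \<inter> Y)" using subT[OF XY(1)] finY[OF XY(1)] by auto
    have "card (induced F (X \<inter> Y)) + 1 \<le> card (X \<inter> Y)"
    proof (cases "2 \<le> card (X \<inter> Y)")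
      case True
      then show ?thesis using sparseD[OF spF sub True] by simp
    next
      case False
      have "card e \<le> card (X \<inter> Y)" if "e \<in> induced F (X \<inter> Y)" for e
        using that finI by (intro card_mono) (auto simp: induced_def)
      then have "induced F (X \<inter> Y) = {}" using False edgeF unfolding induced_def by fastforce
      moreover have "0 < card (X \<inter> Y)" using ne finI by (simp add: card_gt_0_iff)
      ultimately show ?thesis by simp
    qed
    then show False using meetT[OF XY] by simp
  qed
  have meetC': "card (X \<inter> Y) < 2" if XY: "X \<in> C" "Y \<in> C" "X \<noteq> Y" for X Y
  proof (rule ccontr)
    assume "\<not> ?thesis"
    then have "card (induced H (X \<inter> Y)) + b \<le> a * card (X \<inter> Y)"
      using subC[OF XY(1)] by (intro sparseD[OF spH]) auto
    then show False using meetC[OF XY] by simp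
  qed
  \<comment> \<open>The edges of \<open>H\<close> inside \<open>X\<close> are in \<open>A\<close>,
    so each lies in one of the disjoint sets of \<open>T\<close>. By \<open>tight_connected\<close>
    they cannot be distributed over several of them.\<close>
  have CT: "\<exists>Y\<in>T. X \<subseteq> Y" if X: "X \<in> C" for X
  proof -
    have "card (induced H X) + b = a * card X" using C[OF X] by (simp add: tight_def)
    moreover have "a * 3 \<le> a * card X" using C[OF X] by (intro mult_le_mono2) simp
    ultimately have "card (induced H X) \<noteq> 0" using a b by linarith
    then obtain e where e: "e \<in> induced H X" by fastforce
    then obtain Y where Y: "Y \<in> T" "e \<subseteq> Y" using C[OF X] covT by blast
    have "X \<subseteq> Y"
    proof (rule ccontr)
      assume "\<not> X \<subseteq> Y"
      then have ps: "X \<inter> Y \<subset> X" by blast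
      have "e \<subseteq> X \<inter> Y" "card e = 2" using e Y(2) edgeH by (auto simp: induced_def)
      then have c: "2 \<le> card (X \<inter> Y)" using card_mono[of "X \<inter> Y" e] finX[OF X] by simp
      have tX: "tight V a b H X" using C[OF X] by simp
      have "0 < a" "0 < b" using a b by auto
      then obtain f where f: "f \<in> induced H X" "crosses (X \<inter> Y) f"
        using tight_connected[OF finV finH spH edgeH tX ps c] by blast
      then obtain Z where Z: "Z \<in> T" "f \<subseteq> Z" using C[OF X] covT by blast
      have "f \<subseteq> X" using f by (simp add: induced_def)
      then have "Z \<inter> Y \<noteq> {}" "\<not> f \<subseteq> Y" using f(2) Z(2) unfolding crosses_def by blast+
      then show False using disT[OF Z(1) Y(1)] Z(2) by blast
    qed
    then show ?thesis using Y by blast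
  qed
  have "V \<in> C"
  proof (rule ccontr)
    assume nV: "V \<notin> C"
    have C4: "X \<subset> V \<and> 4 \<le> card X" if X: "X \<in> C" for X
    proof -
      \<comment> \<open>A tight set on three vertices would need \<open>3 * a - b = a + 1\<close>
        edges, more than a triangle has as \<open>a \<ge> 3\<close>.\<close>
      have "card X \<noteq> 3"
      proof
        assume c3: "card X = 3"
        have "induced H X \<subseteq> {e. e \<subseteq> X \<and> card e = 2}" using edgeH by (auto simp: induced_def)
        then have "card (induced H X) \<le> card {e. e \<subseteq> X \<and> card e = 2}"
          using finX[OF X] by (intro card_mono) auto
        also have "\<dots> = 3" using n_subsets[OF finX[OF X], of 2] c3 by (simp add: choose_two)
        finally have "card (induced H X) \<le> 3" .
        moreover have "card (induced H X) + b = a * 3" using C[OF X] c3 by (simp add: tight_def)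
        ultimately show False using a b by linarith
      qed
      moreover have "X \<noteq> V" using nV X by blast
      ultimately show ?thesis using C[OF X] subC[OF X] by auto
    qed
    have a1: "1 \<le> a" using a by simp
    \<comment> \<open>The summands \<open>card C + card (V - \<Union>C)\<close> on the left are the
      budget for the tree part, where they reappear in \<open>mainF\<close>.\<close>
    have main: "a * card V + card C + card (V - \<Union>C) + b * card C \<le> a * (\<Sum>X\<in>C. card X) + card (E - A)"
      by (rule weakly_connected_charging[OF finV edge V2 a1 b weak finC C4 covC])
    have "card (H \<inter> A) + b * card C = a * (\<Sum>X\<in>C. card X)"
      using C by (intro card_tight_family[OF finH finC edgeH finX _ covC meetC']) auto
    with main have mainH: "a * card V + card C + card (V - \<Union>C) \<le> card (H \<inter> A) + card (E - A)" by linarith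
    have meetT': "card (X \<inter> Y) < 2" if "X \<in> T" "Y \<in> T" "X \<noteq> Y" for X Y
      using disT[OF that] by simp
    have "card (F \<inter> A) + 1 * card T = 1 * (\<Sum>X\<in>T. card X)"
      using T by (intro card_tight_family[OF finF finT edgeF finY _ covT meetT']) auto
    moreover have "card (\<Union>T) = (\<Sum>X\<in>T. card X)"
      using finY disT by (intro card_Union_disjoint) (auto simp: pairwise_def disjnt_def)
    moreover have "card V = card (\<Union>T) + card (V - \<Union>T)"
      using finV subT by (metis Union_least card_Diff_subset card_mono finite_subset le_add_diff_inverse)
    moreover have "card (V - \<Union>T) \<le> card (V - \<Union>C)"
      using finV CT by (intro card_mono) blast+
    \<comment> \<open>Every set of \<open>T\<close> contains an edge of \<open>A\<close>, and the
      member of \<open>C\<close> around that edge is mapped to this set.\<close>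
    moreover have "card T \<le> card C"
    proof -
      obtain h where h: "\<And>X. X \<in> C \<Longrightarrow> h X \<in> T \<and> X \<subseteq> h X" using CT by metis
      have "T \<subseteq> h ` C"
      proof
        fix Y assume Y: "Y \<in> T"
        have "card (induced F Y) + 1 = card Y" "3 \<le> card Y" using T[OF Y] by (auto simp: tight_def)
        then have "card (induced F Y) \<noteq> 0" by linarith
        then obtain e where e: "e \<in> induced F Y" by fastforce
        then have "e \<in> A" using T[OF Y] by blast
        then obtain X where X: "X \<in> C" "e \<subseteq> X" using covC by blast
        have "card e = 2" "e \<subseteq> Y" using e edgeF by (auto simp: induced_def)
        then have "e \<noteq> {}" "e \<subseteq> Y \<inter> h X" using h[OF X(1)] X(2) by auto
        then have "Y \<inter> h X \<noteq> {}" by blast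
        then have "Y = h X" using disT[OF Y, of "h X"] h[OF X(1)] by blast
        then show "Y \<in> h ` C" using X(1) by blast
      qed
      then show ?thesis using surj_card_le[OF finC] by blast
    qed
    ultimately have mainF: "card V \<le> card (F \<inter> A) + card C + card (V - \<Union>C)" by linarith
    have "card H = card (H \<inter> A) + card (H - A)" "card F = card (F \<inter> A) + card (F - A)"
      using finH finF by (metis Int_Diff_Un Int_Diff_disjoint card_Un_disjoint finite_Diff finite_Int)+
    moreover have "card (E - A) = card (H - A) + card (F - A)"
    proof -
      have "E - A = (H - A) \<union> (F - A)" using EA HE FE unfolding H_def F_def by blast
      then show ?thesis using dis finH finF card_Un_disjoint[of "H - A" "F - A"] by auto
    qed
    ultimately have big: "a * card V + card V \<le> card H + card F" using mainH mainF by linarith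
    have "induced H V = H" "induced F V = F" using HE FE edge unfolding induced_def by blast+
    then have "card H + b \<le> a * card V" "card F + 1 \<le> card V"
      using sparseD[OF spH subset_refl V2] sparseD[OF spF subset_refl V2] by auto
    then show False using big by linarith
  qed
  then obtain Y where "Y \<in> T" "V \<subseteq> Y" using CT by blast
  then have "V \<in> T" using subT by (metis subset_antisym)
  show thesis
    using that[OF HE FE dis spH _ spF] C[OF \<open>V \<in> C\<close>] T[OF \<open>V \<in> T\<close>] by blast
qed

section \<open>T-joins and cuts of tight graphs\<close>

lemma card_split: "finite A \<Longrightarrow> card A = card (A - B) + card (A \<inter> B)"
  by (metis Int_Diff_Un Int_Diff_disjoint add.commute card_Un_disjoint finite_Diff finite_Int)

definition degree :: "'a set set \<Rightarrow> 'a \<Rightarrow> nat" where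
  "degree J x = card {e \<in> J. x \<in> e}"

lemma odd_degree_sym_diff:
  assumes "finite J" "finite L"
  shows "odd (degree ((J - L) \<union> (L - J)) x) \<longleftrightarrow> odd (degree J x) \<noteq> odd (degree L x)"
proof -
  let ?A = "{e \<in> J. x \<in> e}" and ?B = "{e \<in> L. x \<in> e}"
  have fin: "finite ?A" "finite ?B" using assms by auto
  have "{e \<in> (J - L) \<union> (L - J). x \<in> e} = (?A - ?B) \<union> (?B - ?A)" by blast
  then have 1: "degree ((J - L) \<union> (L - J)) x = card (?A - ?B) + card (?B - ?A)"
    unfolding degree_def using card_Un_disjoint[of "?A - ?B" "?B - ?A"] fin by auto
  have "card ?A = card (?A - ?B) + card (?A \<inter> ?B)" "card ?B = card (?B - ?A) + card (?A \<inter> ?B)"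
    using card_split[OF fin(1), of ?B] card_split[OF fin(2), of ?A] by (simp_all add: Int_commute)
  then show ?thesis unfolding 1 by (simp add: degree_def) blast
qed

lemma handshake:
  assumes "finite V" "finite J" "\<And>e. e \<in> J \<Longrightarrow> e \<subseteq> V \<and> card e = 2"
  shows "(\<Sum>x\<in>V. degree J x) = 2 * card J"
proof -
  have "(\<Sum>x\<in>V. degree J x) = (\<Sum>x\<in>V. \<Sum>e\<in>J. if x \<in> e then 1 else 0)"
    unfolding degree_def using assms(2) by (simp add: sum.If_cases Int_def)
  also have "\<dots> = (\<Sum>e\<in>J. \<Sum>x\<in>V. if x \<in> e then 1 else 0)" by (rule sum.swap)
  also have "\<dots> = (\<Sum>e\<in>J. 2)"
    using assms by (intro sum.cong) (auto simp: sum.If_cases Int_absorb1)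
  finally show ?thesis by simp
qed

lemma even_card_odd_degree:
  assumes "finite V" "finite J" "\<And>e. e \<in> J \<Longrightarrow> e \<subseteq> V \<and> card e = 2"
  shows "even (card {x \<in> V. odd (degree J x)})"
  using handshake[OF assms] even_sum_iff[of V "degree J"] assms(1) by simp

text \<open>No paths are needed: the vertices that can be joined to \<open>u\<close> form a set
  crossed by no edge, since the symmetric difference with a crossing edge would enlarge it. For
  \<open>u = v\<close> the join is empty.\<close>

lemma T_join_pair:
  assumes finF: "finite F" and edge: "\<And>e. e \<in> F \<Longrightarrow> e \<subseteq> V \<and> card e = 2"
    and conn: "\<And>X. X \<subset> V \<Longrightarrow> X \<noteq> {} \<Longrightarrow> \<exists>e\<in>F. crosses X e"
    and uv: "u \<in> V" "v \<in> V"
  shows "\<exists>J\<subseteq>F. \<forall>z. odd (degree J z) \<longleftrightarrow> (z = u) \<noteq> (z = v)"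
proof -
  define R where "R = {v \<in> V. \<exists>J\<subseteq>F. \<forall>z. odd (degree J z) \<longleftrightarrow> (z = u) \<noteq> (z = v)}"
  have "u \<in> R" using uv unfolding R_def by (auto intro!: exI[of _ "{}"] simp: degree_def)
  have "R = V"
  proof (rule ccontr)
    assume "R \<noteq> V"
    then have "R \<subset> V" unfolding R_def by blast
    then obtain e where e: "e \<in> F" "crosses R e" using conn \<open>u \<in> R\<close> by blast
    obtain x y where xy: "e = {x, y}" "x \<in> R" "y \<notin> R"
    proof -
      obtain p q where "e = {p, q}" using edge[OF e(1)] by (auto simp: card_2_iff)
      then show thesis using e(2) that[of p q] that[of q p] by (auto simp: insert_commute)
    qed
    then obtain J where J: "J \<subseteq> F" "\<And>z. odd (degree J z) \<longleftrightarrow> (z = u) \<noteq> (z = x)"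
      unfolding R_def by blast
    let ?L = "(J - {e}) \<union> ({e} - J)"
    have "x \<noteq> y" using xy by blast
    have "degree {e} z = of_bool (z = x \<or> z = y)" for z
    proof -
      have "{f \<in> {e}. z \<in> f} = (if z = x \<or> z = y then {e} else {})" using xy(1) by auto
      then show ?thesis by (simp add: degree_def)
    qed
    then have deg_e: "odd (degree {e} z) \<longleftrightarrow> (z = x) \<noteq> (z = y)" for z using \<open>x \<noteq> y\<close> by simp
    have "odd (degree ?L z) \<longleftrightarrow> (z = u) \<noteq> (z = y)" for z
      unfolding odd_degree_sym_diff[OF finite_subset[OF J(1) finF] finite.insertI[OF finite.emptyI]] J(2) deg_e by blast
    moreover have "?L \<subseteq> F" using J(1) e(1) by blast
    moreover have "y \<in> V" using edge[OF e(1)] xy(1) by blast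
    ultimately have "y \<in> R" unfolding R_def by blast
    then show False using xy by blast
  qed
  then show ?thesis using uv(2) unfolding R_def by blast
qed

lemma T_join:
  assumes finV: "finite V" and finF: "finite F" and edge: "\<And>e. e \<in> F \<Longrightarrow> e \<subseteq> V \<and> card e = 2"
    and conn: "\<And>X. X \<subset> V \<Longrightarrow> X \<noteq> {} \<Longrightarrow> \<exists>e\<in>F. crosses X e"
    and "T \<subseteq> V" "even (card T)"
  shows "\<exists>J\<subseteq>F. \<forall>z. odd (degree J z) \<longleftrightarrow> z \<in> T"
  using assms(5,6)
proof (induction "card T" arbitrary: T rule: less_induct)
  case less
  have finT: "finite T" using less.prems(1) finV by (rule finite_subset)
  show ?case
  proof (cases "T = {}")
    case True
    then show ?thesis by (intro exI[of _ "{}"]) (simp add: degree_def)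
  next
    case False
    then obtain u where u: "u \<in> T" by blast
    have "T \<noteq> {u}" using less.prems(2) by auto
    then obtain v where v: "v \<in> T" "v \<noteq> u" using u by blast
    let ?T = "T - {u, v}"
    have "card ({u, v}) \<le> card T" using u v finT by (intro card_mono) auto
    then have "2 \<le> card T" using v by simp
    then have c: "card ?T = card T - 2" using u v finT by (subst card_Diff_subset) auto
    then have "card ?T < card T" "even (card ?T)" using \<open>2 \<le> card T\<close> less.prems(2) by auto
    then obtain J where J: "J \<subseteq> F" "\<And>z. odd (degree J z) \<longleftrightarrow> z \<in> ?T"
      using less.hyps[of ?T] less.prems(1) by blast
    have uvV: "u \<in> V" "v \<in> V" using u v less.prems(1) by auto
    obtain L where L: "L \<subseteq> F" "\<And>z. odd (degree L z) \<longleftrightarrow> (z = u) \<noteq> (z = v)"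
      using T_join_pair[OF finF edge conn uvV] by blast
    have "odd (degree ((J - L) \<union> (L - J)) z) \<longleftrightarrow> z \<in> T" for z
      unfolding odd_degree_sym_diff[OF finite_subset[OF J(1) finF] finite_subset[OF L(1) finF]] J(2) L(2)
      using u v by (cases "z = u"; cases "z = v"; simp)
    moreover have "(J - L) \<union> (L - J) \<subseteq> F" using J(1) L(1) by blast
    ultimately show ?thesis by blast
  qed
qed

section \<open>Cut bounds from sparsity counts\<close>

lemma cut_of_tight:
  assumes fin: "finite H" and t: "tight V a b H V"
    and c: "card (induced H X) + card (induced H (V - X)) + c + b \<le> a * card V"
  shows "c \<le> card {e \<in> H. crosses X e}"
proof -
  have "induced H V \<subseteq> (induced H X \<union> induced H (V - X)) \<union> {e \<in> H. crosses X e}"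
    unfolding induced_def crosses_def by blast
  then have "card (induced H V) \<le> card ((induced H X \<union> induced H (V - X)) \<union> {e \<in> H. crosses X e})"
    using fin by (intro card_mono) (auto simp: induced_def)
  also have "\<dots> \<le> card (induced H X) + card (induced H (V - X)) + card {e \<in> H. crosses X e}"
    by (meson add_mono card_Un_le order_refl order_trans)
  finally show ?thesis using t c by (simp add: tight_def)
qed

text \<open>\<open>(a |V| - b) - (a |X| - b) - (a |V - X| - b) = b\<close>. Two vertices on each
  side are required for both sparsity bounds.\<close>

lemma tight_cut:
  assumes finV: "finite V" and fin: "finite H"
    and sp: "sparse V a b H" and t: "tight V a b H V" and X: "X \<subseteq> V" "2 \<le> card X" "2 \<le> card (V - X)"
  shows "b \<le> card {e \<in> H. crosses X e}"
proof (rule cut_of_tight[OF fin t])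
  have "card V = card X + card (V - X)"
    using finV X(1) by (metis card_Diff_subset card_mono finite_subset le_add_diff_inverse)
  then have "a * card V = a * card X + a * card (V - X)" by (simp add: distrib_left)
  moreover have "card (induced H X) + b \<le> a * card X" by (rule sparseD[OF sp X(1,2)])
  moreover have "card (induced H (V - X)) + b \<le> a * card (V - X)" using sparseD[OF sp _ X(3)] by blast
  ultimately show "card (induced H X) + card (induced H (V - X)) + b + b \<le> a * card V" by linarith
qed

lemma spanning_tree_crosses:
  assumes finV: "finite V" and fin: "finite F" and edge: "\<And>e. e \<in> F \<Longrightarrow> e \<subseteq> V \<and> card e = 2"
    and sp: "sparse V 1 1 F" and t: "tight V 1 1 F V" and X: "X \<subset> V" "X \<noteq> {}"
  shows "\<exists>e\<in>F. crosses X e"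
proof -
  have forest: "card (induced F Y) + 1 \<le> card Y" if Y: "Y \<subseteq> V" "Y \<noteq> {}" for Y
  proof (cases "2 \<le> card Y")
    case True
    then show ?thesis using sparseD[OF sp Y(1)] by simp
  next
    case False
    have finY: "finite Y" using Y finV by (meson finite_subset)
    have "card e \<le> card Y" if "e \<in> induced F Y" for e
      using that finY by (intro card_mono) (auto simp: induced_def)
    then have "induced F Y = {}" using False edge unfolding induced_def by fastforce
    then show ?thesis using Y finY by (simp add: Suc_le_eq card_gt_0_iff)
  qed
  have "1 \<le> card {e \<in> F. crosses X e}"
  proof (rule cut_of_tight[OF fin t])
    have "card V = card X + card (V - X)"
      using finV X(1) by (metis card_Diff_subset card_mono finite_subset le_add_diff_inverse psubset_imp_subset)
    moreover have "V - X \<noteq> {}" using X by blast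
    ultimately show "card (induced F X) + card (induced F (V - X)) + 1 + 1 \<le> 1 * card V"
      using forest[of X] forest[of "V - X"] X by auto
  qed
  then have "{e \<in> F. crosses X e} \<noteq> {}" by (metis card.empty not_one_le_zero)
  then show ?thesis by blast
qed

text \<open>Counted with the overlapping sets \<open>insert v X\<close> and \<open>V - X\<close>:
  every edge at \<open>v\<close> lies inside one of them, and both have at least two vertices even
  if \<open>X\<close> is a single vertex. Counting \<open>v\<close> twice costs the summand
  \<open>a\<close>.\<close>

lemma tight_vertex_deleted_cut:
  assumes finV: "finite V" and fin: "finite H" and edge: "\<And>e. e \<in> H \<Longrightarrow> e \<subseteq> V \<and> card e = 2"
    and sp: "sparse V a b H" and t: "tight V a b H V" and v: "v \<in> V" and X: "X \<subset> V - {v}" "X \<noteq> {}"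
  shows "b \<le> card {e \<in> H. v \<notin> e \<and> crosses X e} + a"
proof -
  let ?P = "insert v X" and ?Q = "V - X"
  have finX: "finite X" using X finV by (meson finite_Diff finite_subset psubset_imp_subset)
  obtain y where y: "y \<in> V" "y \<noteq> v" "y \<notin> X" using X by blast
  have "v \<notin> X" using X by blast
  obtain x where x: "x \<in> X" "x \<noteq> v" using X \<open>v \<notin> X\<close> by blast
  have "card {v, x} \<le> card ?P" "card {v, y} \<le> card ?Q"
    using finX finV x y v \<open>v \<notin> X\<close> by (intro card_mono; auto)+
  then have c: "2 \<le> card ?P" "2 \<le> card ?Q" using x y \<open>v \<notin> X\<close> by (simp_all add: card_insert_if split: if_splits)
  have sub: "?P \<subseteq> V" "?Q \<subseteq> V" using X v by auto
  have "e \<in> induced H ?P \<or> e \<in> induced H ?Q \<or> e \<in> {e \<in> H. v \<notin> e \<and> crosses X e}" if e: "e \<in> induced H V" for e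
  proof -
    obtain p q where "e = {p, q}" using edge[of e] e by (auto simp: induced_def card_2_iff)
    then show ?thesis using e \<open>v \<notin> X\<close> by (auto simp: induced_def)
  qed
  then have "induced H V \<subseteq> (induced H ?P \<union> induced H ?Q) \<union> {e \<in> H. v \<notin> e \<and> crosses X e}" by blast
  then have "card (induced H V) \<le> card ((induced H ?P \<union> induced H ?Q) \<union> {e \<in> H. v \<notin> e \<and> crosses X e})"
    using fin by (intro card_mono) (auto simp: induced_def)
  also have "\<dots> \<le> card (induced H ?P) + card (induced H ?Q) + card {e \<in> H. v \<notin> e \<and> crosses X e}"
    by (meson add_mono card_Un_le order_refl order_trans)
  finally have "card (induced H V) \<le> card (induced H ?P) + card (induced H ?Q) + card {e \<in> H. v \<notin> e \<and> crosses X e}" .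
  moreover have "card (induced H ?P) + b \<le> a * card ?P" "card (induced H ?Q) + b \<le> a * card ?Q"
    using sparseD[OF sp sub(1) c(1)] sparseD[OF sp sub(2) c(2)] by auto
  moreover have "card ?P + card ?Q = card V + 1"
  proof -
    have "card ?Q = card V - card X" "card X \<le> card V"
      using X finX finV by (auto intro!: card_Diff_subset card_mono)
    then show ?thesis using \<open>v \<notin> X\<close> finX by simp
  qed
  then have "a * card ?P + a * card ?Q = a * card V + a" by (metis distrib_left mult.right_neutral)
  moreover have "card (induced H V) + b = a * card V" using t by (simp add: tight_def)
  ultimately show ?thesis by linarith
qed

lemma even_involution:
  assumes "finite A" "even (card A)"
  shows "\<exists>\<rho>. \<forall>x\<in>A. \<rho> x \<in> A \<and> \<rho> x \<noteq> x \<and> \<rho> (\<rho> x) = x"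
  using assms
proof (induction "card A" arbitrary: A rule: less_induct)
  case less
  show ?case
  proof (cases "A = {}")
    case False
    then obtain u where u: "u \<in> A" by blast
    have "A \<noteq> {u}" using less.prems(2) by auto
    then obtain v where v: "v \<in> A" "v \<noteq> u" using u by blast
    let ?B = "A - {u, v}"
    have "card {u, v} \<le> card A" using u v less.prems(1) by (intro card_mono) auto
    then have "2 \<le> card A" using v by simp
    have "card ?B = card A - 2" using u v less.prems(1) by (subst card_Diff_subset) auto
    then have "card ?B < card A" "even (card ?B)" using \<open>2 \<le> card A\<close> less.prems(2) by auto
    then obtain \<rho> where \<rho>: "\<And>x. x \<in> ?B \<Longrightarrow> \<rho> x \<in> ?B \<and> \<rho> x \<noteq> x \<and> \<rho> (\<rho> x) = x"
      using less.hyps[of ?B] less.prems(1) by blast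
    define \<tau> where "\<tau> = \<rho>(u := v, v := u)"
    have "\<tau> x \<in> A \<and> \<tau> x \<noteq> x \<and> \<tau> (\<tau> x) = x" if x: "x \<in> A" for x
    proof (cases "x \<in> ?B")
      case True
      then show ?thesis using \<rho>[OF True] unfolding \<tau>_def by auto
    next
      case False
      then show ?thesis using x u v unfolding \<tau>_def by auto
    qed
    then show ?thesis by blast
  qed simp
qed

section \<open>The orientation\<close>

lemma mcut_mset_set: "finite L \<Longrightarrow> mcut (mset_set L) X = card {e \<in> L. crosses X e}"
  by (simp add: mcut_def filter_mset_mset_set)

text \<open>The second property bounds how unbalanced \<open>X\<close> can become when
  \<open>v\<close> is removed from an orientation that follows \<open>\<pi>\<close>: only neighbours
  in \<open>X\<close> with partner outside \<open>X\<close> matter.\<close>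

lemma transitions_at_vertex:
  assumes finV: "finite V" and finK: "finite K" and edge: "\<And>e. e \<in> K \<Longrightarrow> e \<subseteq> V \<and> card e = 2"
    and even: "\<And>x. even (degree K x)"
    and conn: "\<And>X. X \<subset> V - {v} \<Longrightarrow> X \<noteq> {} \<Longrightarrow> 2 * k \<le> card {e \<in> K. v \<notin> e \<and> crosses X e}"
  shows "\<exists>\<pi>. (\<forall>x. {v, x} \<in> K \<longrightarrow> \<pi> x \<noteq> x \<and> {v, \<pi> x} \<in> K \<and> \<pi> (\<pi> x) = x) \<and>
    (\<forall>X. X \<subset> V - {v} \<longrightarrow> X \<noteq> {} \<longrightarrow>
      card {x \<in> X. {v, x} \<in> K \<and> \<pi> x \<notin> X} + 2 * k \<le> card {e \<in> K. v \<notin> e \<and> crosses X e})"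
proof -
  define L where "L = {e \<in> K. v \<notin> e}"
  have finL: "finite L" using finK by (simp add: L_def)
  have cut: "mcut (mset_set L) X = card {e \<in> K. v \<notin> e \<and> crosses X e}" for X
    using mcut_mset_set[OF finL, of X] by (simp add: L_def conj_assoc)
  have in_L: "edges_in (V - {v}) (mset_set L)"
    unfolding edges_in_def
  proof
    fix e assume "e \<in># mset_set L"
    then have e: "e \<in> K" "v \<notin> e" using finL by (auto simp: L_def)
    then obtain x y where "e = {x, y}" using edge[of e] by (auto simp: card_2_iff)
    then show "\<exists>x\<in>V - {v}. \<exists>y\<in>V - {v}. e = {x, y}" using e edge[OF e(1)] by auto
  qed
  have "\<exists>M. edges_in (V - {v}) M \<and> (\<forall>x\<in>V - {v}. even (mcut M {x} + mcut (mset_set L) {x}))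
    \<and> (\<forall>X. X \<subset> V - {v} \<longrightarrow> X \<noteq> {} \<longrightarrow> mcut M X + 2 * k \<le> mcut (mset_set L) X)"
    by (rule odd_vertex_pairing[OF _ in_L]) (use finV conn cut in auto)
  then obtain M where M: "edges_in (V - {v}) M"
    and Mpar: "\<And>x. x \<in> V - {v} \<Longrightarrow> even (mcut M {x} + mcut (mset_set L) {x})"
    and Mcut: "\<And>X. X \<subset> V - {v} \<Longrightarrow> X \<noteq> {} \<Longrightarrow> mcut M X + 2 * k \<le> mcut (mset_set L) X" by blast
  have odd_iff: "odd (mcut M {x}) \<longleftrightarrow> {v, x} \<in> K" for x
  proof (cases "x \<in> V - {v}")
    case True
    have "crosses {x} e \<longleftrightarrow> x \<in> e" if "e \<in> K" for e
      using edge[OF that] by (auto simp: card_2_iff)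
    then have "mcut (mset_set L) {x} = card {e \<in> K. v \<notin> e \<and> x \<in> e}"
      unfolding cut by (intro arg_cong[where f = card]) auto
    moreover have "degree K x = card {e \<in> K. v \<notin> e \<and> x \<in> e} + card {e \<in> K. v \<in> e \<and> x \<in> e}"
    proof -
      have "{e \<in> K. x \<in> e} = {e \<in> K. v \<notin> e \<and> x \<in> e} \<union> {e \<in> K. v \<in> e \<and> x \<in> e}" by blast
      then show ?thesis unfolding degree_def using finK by (simp add: card_Un_disjoint disjoint_iff)
    qed
    moreover have "{e \<in> K. v \<in> e \<and> x \<in> e} = (if {v, x} \<in> K then {{v, x}} else {})"
    proof -
      have "e = {v, x}" if e: "e \<in> K" "v \<in> e" "x \<in> e" for e
      proof -
        obtain p q where "e = {p, q}" using edge[OF e(1)] by (auto simp: card_2_iff)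
        then show ?thesis using e True by blast
      qed
      then have "e \<in> {e \<in> K. v \<in> e \<and> x \<in> e} \<longleftrightarrow> e = {v, x} \<and> {v, x} \<in> K" for e by blast
      then show ?thesis by (cases "{v, x} \<in> K") (simp_all add: set_eq_iff[of _ "{{v, x}}"] set_eq_iff[of _ "{}"])
    qed
    ultimately show ?thesis using Mpar[OF True] even[of x] by (auto split: if_splits)
  next
    case False
    have "mcut M {x} = 0" using M False by (induction M) auto
    moreover have "{v, x} \<notin> K" using False edge[of "{v, x}"] by (auto split: if_splits)
    ultimately show ?thesis by simp
  qed
  have "\<exists>\<pi>. (\<forall>x. odd (mcut M {x}) \<longrightarrow> \<pi> x \<noteq> x \<and> odd (mcut M {\<pi> x}) \<and> \<pi> (\<pi> x) = x)
    \<and> (\<forall>X. card {x \<in> X. odd (mcut M {x}) \<and> \<pi> x \<notin> X} \<le> mcut M X)"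
    by (rule odd_vertex_involution[OF M]) blast
  then obtain \<pi> where \<pi>: "\<And>x. odd (mcut M {x}) \<Longrightarrow> \<pi> x \<noteq> x \<and> odd (mcut M {\<pi> x}) \<and> \<pi> (\<pi> x) = x"
    "\<And>X. card {x \<in> X. odd (mcut M {x}) \<and> \<pi> x \<notin> X} \<le> mcut M X" by blast
  show ?thesis
  proof (intro exI[of _ \<pi>] conjI allI impI)
    fix x assume "{v, x} \<in> K"
    then show "\<pi> x \<noteq> x" "{v, \<pi> x} \<in> K" "\<pi> (\<pi> x) = x" using \<pi>(1)[of x] odd_iff by auto
  next
    fix X assume X: "X \<subset> V - {v}" "X \<noteq> {}"
    show "card {x \<in> X. {v, x} \<in> K \<and> \<pi> x \<notin> X} + 2 * k \<le> card {e \<in> K. v \<notin> e \<and> crosses X e}"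
      using Mcut[OF X] \<pi>(2)[of X] unfolding cut odd_iff by linarith
  qed
qed

section \<open>Counting arcs across cuts\<close>

lemma card_arcs_eq_card_edges:
  assumes D: "D \<union> D\<inverse> = {(u, w). {u, w} \<in> K}" "D \<inter> D\<inverse> = {}" and edge: "\<And>e. e \<in> K \<Longrightarrow> card e = 2"
  shows "card {(u, w). (u, w) \<in> D \<and> Q {u, w}} = card {e \<in> K. Q e}"
proof (rule bij_betw_same_card)
  show "bij_betw (\<lambda>(u, w). {u, w}) {(u, w). (u, w) \<in> D \<and> Q {u, w}} {e \<in> K. Q e}"
    unfolding bij_betw_def
  proof
    show "inj_on (\<lambda>(u, w). {u, w}) {(u, w). (u, w) \<in> D \<and> Q {u, w}}"
      using D(2) by (auto simp: inj_on_def doubleton_eq_iff)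
    show "(\<lambda>(u, w). {u, w}) ` {(u, w). (u, w) \<in> D \<and> Q {u, w}} = {e \<in> K. Q e}" (is "?f ` ?A = _")
    proof (intro equalityI subsetI)
      fix e assume "e \<in> ?f ` ?A"
      then show "e \<in> {e \<in> K. Q e}" using D(1) by auto
    next
      fix e assume e: "e \<in> {e \<in> K. Q e}"
      then obtain u w where uw: "e = {u, w}" using edge[of e] by (auto simp: card_2_iff)
      then have "(u, w) \<in> D \<or> (w, u) \<in> D" using e D(1) by blast
      then show "e \<in> ?f ` ?A"
      proof
        assume "(u, w) \<in> D"
        then have "(u, w) \<in> ?A" using e uw by simp
        then show ?thesis using uw by force
      next
        assume "(w, u) \<in> D"
        then have "(w, u) \<in> ?A" using e uw by (simp add: insert_commute)
        then show ?thesis using uw by force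
      qed
    qed
  qed
qed

lemma balanced_cut:
  assumes fin: "finite D" "finite X" and bal: "\<And>v. v \<in> X \<Longrightarrow> card {u. (u, v) \<in> D} = card {w. (v, w) \<in> D}"
  shows "card {(u, w). (u, w) \<in> D \<and> u \<notin> X \<and> w \<in> X} = card {(u, w). (u, w) \<in> D \<and> u \<in> X \<and> w \<notin> X}"
proof -
  let ?i = "{(u, w). (u, w) \<in> D \<and> u \<notin> X \<and> w \<in> X}" and ?o = "{(u, w). (u, w) \<in> D \<and> u \<in> X \<and> w \<notin> X}"
    and ?m = "{(u, w). (u, w) \<in> D \<and> u \<in> X \<and> w \<in> X}"
  have sub: "?i \<subseteq> D" "?o \<subseteq> D" "?m \<subseteq> D" by auto
  have fins: "finite ?i" "finite ?o" "finite ?m" using sub fin(1) by (auto intro: finite_subset)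
  have nb: "finite {w. (v, w) \<in> D}" "finite {u. (u, v) \<in> D}" for v
    using finite_subset[of "{w. (v, w) \<in> D}" "snd ` D"] finite_subset[of "{u. (u, v) \<in> D}" "fst ` D"] fin(1)
    by force+
  have "?o \<union> ?m = Sigma X (\<lambda>v. {w. (v, w) \<in> D})" by auto
  then have "card (?o \<union> ?m) = (\<Sum>v\<in>X. card {w. (v, w) \<in> D})" using fin(2) nb by simp
  moreover have "card (?o \<union> ?m) = card ?o + card ?m" using fins by (intro card_Un_disjoint) auto
  moreover have "?i \<union> ?m = prod.swap ` Sigma X (\<lambda>v. {u. (u, v) \<in> D})" by force
  then have "card (?i \<union> ?m) = (\<Sum>v\<in>X. card {u. (u, v) \<in> D})" using fin(2) nb by (simp add: card_image)
  moreover have "card (?i \<union> ?m) = card ?i + card ?m" using fins by (intro card_Un_disjoint) auto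
  moreover have "(\<Sum>v\<in>X. card {w. (v, w) \<in> D}) = (\<Sum>v\<in>X. card {u. (u, v) \<in> D})" using bal by simp
  ultimately show ?thesis by linarith
qed

lemma transition_balanced:
  assumes tr: "\<And>u. u \<in> N \<Longrightarrow> (u, v) \<in> D \<longleftrightarrow> (v, \<pi> u) \<in> D"
    and \<pi>: "\<And>u. u \<in> N \<Longrightarrow> \<pi> u \<in> N \<and> \<pi> (\<pi> u) = u"
  shows "card {u \<in> N. (u, v) \<in> D} = card {u \<in> N. (v, u) \<in> D}"
proof (rule bij_betw_same_card)
  show "bij_betw \<pi> {u \<in> N. (u, v) \<in> D} {u \<in> N. (v, u) \<in> D}"
    by (rule bij_betw_byWitness[where f' = \<pi>]) (use tr \<pi> in auto)
qed

text \<open>\<open>X\<close> is balanced before \<open>v\<close> is removed. An arc from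
  \<open>v\<close> to \<open>x\<close> continues the arc from \<open>\<pi> x\<close> to
  \<open>v\<close>, which leaves \<open>X\<close> unless \<open>\<pi> x\<close> lies outside
  \<open>X\<close>. So removing \<open>v\<close> costs at most \<open>card ?R\<close> more entering
  than leaving arcs, and half of the remaining cut after subtracting \<open>card ?R\<close> enters
  \<open>X\<close>.\<close>

lemma vertex_deleted_in_degree:
  assumes finD: "finite D" and D: "D \<union> D\<inverse> = {(u, w). {u, w} \<in> K}" "D \<inter> D\<inverse> = {}"
    and edge: "\<And>e. e \<in> K \<Longrightarrow> card e = 2"
    and finX: "finite X" and vX: "v \<notin> X"
    and bal: "\<And>x. x \<in> X \<Longrightarrow> card {u. (u, x) \<in> D} = card {w. (x, w) \<in> D}"
    and \<pi>: "\<And>x. {v, x} \<in> K \<Longrightarrow> {v, \<pi> x} \<in> K \<and> \<pi> (\<pi> x) = x"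
    and tr: "\<And>x. {v, x} \<in> K \<Longrightarrow> (x, v) \<in> D \<longleftrightarrow> (v, \<pi> x) \<in> D"
    and cut: "card {x \<in> X. {v, x} \<in> K \<and> \<pi> x \<notin> X} + 2 * k \<le> card {e \<in> K. v \<notin> e \<and> crosses X e}"
  shows "k \<le> card {(u, w). (u, w) \<in> D \<and> u \<noteq> v \<and> w \<noteq> v \<and> u \<notin> X \<and> w \<in> X}"
proof -
  let ?i = "{(u, w). (u, w) \<in> D \<and> u \<notin> X \<and> w \<in> X}" and ?o = "{(u, w). (u, w) \<in> D \<and> u \<in> X \<and> w \<notin> X}"
  let ?i' = "{(u, w). (u, w) \<in> D \<and> u \<noteq> v \<and> w \<noteq> v \<and> u \<notin> X \<and> w \<in> X}"
  let ?o' = "{(u, w). (u, w) \<in> D \<and> u \<noteq> v \<and> w \<noteq> v \<and> u \<in> X \<and> w \<notin> X}"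
  let ?P = "{x \<in> X. (v, x) \<in> D}" and ?Q = "{x \<in> X. (x, v) \<in> D}" and ?R = "{x \<in> X. {v, x} \<in> K \<and> \<pi> x \<notin> X}"
  have sub: "?i \<subseteq> D" "?o \<subseteq> D" "?i' \<subseteq> D" "?o' \<subseteq> D" by auto
  have fins: "finite ?i'" "finite ?o'" using sub finD by (auto intro: finite_subset)
  have K: "{u, w} \<in> K" if "(u, w) \<in> D" for u w using that D(1) by blast
  have "?i = ?i' \<union> Pair v ` ?P" using vX by auto
  moreover have "card (?i' \<union> Pair v ` ?P) = card ?i' + card (Pair v ` ?P)"
    using fins finX by (intro card_Un_disjoint) auto
  moreover have "card (Pair v ` ?P) = card ?P" by (intro card_image) (auto simp: inj_on_def)
  ultimately have i: "card ?i = card ?i' + card ?P" by simp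
  have "?o = ?o' \<union> (\<lambda>x. (x, v)) ` ?Q" using vX by auto
  moreover have "card (?o' \<union> (\<lambda>x. (x, v)) ` ?Q) = card ?o' + card ((\<lambda>x. (x, v)) ` ?Q)"
    using fins finX by (intro card_Un_disjoint) auto
  moreover have "card ((\<lambda>x. (x, v)) ` ?Q) = card ?Q" by (intro card_image) (auto simp: inj_on_def)
  ultimately have o: "card ?o = card ?o' + card ?Q" by simp
  have io: "card ?i = card ?o" by (rule balanced_cut[OF finD finX bal])
  have "{(u, w). (u, w) \<in> D \<and> v \<notin> {u, w} \<and> crosses X {u, w}} = ?i' \<union> ?o'" by auto
  moreover have "card (?i' \<union> ?o') = card ?i' + card ?o'" using fins by (intro card_Un_disjoint) auto
  ultimately have c: "card {e \<in> K. v \<notin> e \<and> crosses X e} = card ?i' + card ?o'"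
    using card_arcs_eq_card_edges[OF D edge, of "\<lambda>e. v \<notin> e \<and> crosses X e"] by simp
  have "card ?P \<le> card (?R \<union> \<pi> ` ?Q)"
  proof (rule card_mono)
    show "finite (?R \<union> \<pi> ` ?Q)" using finX by simp
    show "?P \<subseteq> ?R \<union> \<pi> ` ?Q"
    proof
      fix x assume x: "x \<in> ?P"
      then have "{v, x} \<in> K" using K by blast
      then have y: "{v, \<pi> x} \<in> K" "\<pi> (\<pi> x) = x" using \<pi> by auto
      then have "(\<pi> x, v) \<in> D" using tr[OF y(1)] x by simp
      then show "x \<in> ?R \<union> \<pi> ` ?Q" using x y \<open>{v, x} \<in> K\<close> by (cases "\<pi> x \<in> X") force+
    qed
  qed
  also have "\<dots> \<le> card ?R + card (\<pi> ` ?Q)" by (rule card_Un_le)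
  also have "\<dots> \<le> card ?R + card ?Q" using finX by (simp add: card_image_le)
  finally show ?thesis using i o io c cut by linarith
qed

text \<open>A new vertex \<open>None\<close> is joined to the vertices of odd degree, so that a single Eulerian orientation
  yields a smooth one.\<close>

lemma smooth_transition_orientation:
  fixes V :: "'a set"
  assumes finV: "finite V" and edge: "\<And>e. e \<in> E \<Longrightarrow> e \<subseteq> V \<and> card e = 2" and KE: "K \<subseteq> E"
    and evenK: "\<And>x. even (degree K x)"
    and \<pi>: "\<And>v x. {v, x} \<in> K \<Longrightarrow> \<pi> v x \<noteq> x \<and> {v, \<pi> v x} \<in> K \<and> \<pi> v (\<pi> v x) = x"
  obtains D where "D \<union> D\<inverse> = {(u, w). {u, w} \<in> E}" "D \<inter> D\<inverse> = {}"
    "\<And>v. \<bar>int (card {w. (v, w) \<in> D}) - int (card {u. (u, v) \<in> D})\<bar> \<le> 1"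
    "\<And>v x. {v, x} \<in> K \<Longrightarrow> (x, v) \<in> D \<longleftrightarrow> (v, \<pi> v x) \<in> D"
proof -
  define T where "T = {x \<in> V. odd (degree E x)}"
  have finE: "finite E" by (rule finite_subset[of _ "Pow V"]) (use edge finV in auto)
  have finT: "finite T" using finV by (simp add: T_def)
  have finJ: "finite {x. {v, x} \<in> E - K}" for v
    by (rule finite_subset[of _ V]) (use edge finV in auto)
  define S where "S = {(Some u, Some w) | u w. {u, w} \<in> E} \<union> (\<lambda>w. (None, Some w)) ` T \<union> (\<lambda>w. (Some w, None)) ` T"
  have SS: "(Some u, Some w) \<in> S \<longleftrightarrow> {u, w} \<in> E" and SN: "(None, Some w) \<in> S \<longleftrightarrow> w \<in> T"
    and NS: "(Some w, None) \<in> S \<longleftrightarrow> w \<in> T" and NN: "(None, None) \<notin> S" for u w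
    by (auto simp: S_def)
  \<comment> \<open>The neighbours without prescribed transition. Their number is even:
    \<open>K\<close> has even degrees, and \<open>None\<close> corrects the parity exactly at the
    vertices of \<open>T\<close>. So they can be paired arbitrarily.\<close>
  define rest where "rest v = Some ` {x. {v, x} \<in> E - K} \<union> (if v \<in> T then {None} else {})" for v
  have rest_S: "q \<in> rest v \<Longrightarrow> (q, Some v) \<in> S" for q v
    by (auto simp: rest_def SS SN insert_commute split: if_splits)
  have restI: "q \<in> rest v \<or> (\<exists>x. q = Some x \<and> {v, x} \<in> K)" if "(q, Some v) \<in> S" for q v
    using that by (cases q) (auto simp: rest_def SS SN insert_commute)
  have rest_K: "{v, x} \<in> K \<Longrightarrow> Some x \<notin> rest v" for v x by (auto simp: rest_def)
  have even_rest: "even (card (rest v))" for v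
  proof -
    have "bij_betw (\<lambda>x. {v, x}) {x. {v, x} \<in> E - K} {e \<in> E - K. v \<in> e}"
      unfolding bij_betw_def
    proof
      show "inj_on (\<lambda>x. {v, x}) {x. {v, x} \<in> E - K}" by (auto simp: inj_on_def doubleton_eq_iff)
      have "\<exists>x. e = {v, x}" if "e \<in> E" "v \<in> e" for e using edge[OF that(1)] that(2) by (auto simp: card_2_iff)
      then show "(\<lambda>x. {v, x}) ` {x. {v, x} \<in> E - K} = {e \<in> E - K. v \<in> e}" by force
    qed
    then have cJ: "card {x. {v, x} \<in> E - K} = card {e \<in> E - K. v \<in> e}" by (rule bij_betw_same_card)
    have "degree E v = card {e \<in> E - K. v \<in> e} + degree K v"
    proof -
      have "{e \<in> E. v \<in> e} = {e \<in> E - K. v \<in> e} \<union> {e \<in> K. v \<in> e}" using KE by blast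
      moreover have "finite K" using KE finE by (rule finite_subset)
      ultimately show ?thesis unfolding degree_def using finE by (simp add: card_Un_disjoint disjoint_iff)
    qed
    then have par: "odd (card {x. {v, x} \<in> E - K}) \<longleftrightarrow> odd (degree E v)" using evenK[of v] cJ by simp
    have TV: "v \<in> T \<longleftrightarrow> odd (degree E v)"
    proof -
      have "degree E v = 0" if "v \<notin> V"
      proof -
        have "{e \<in> E. v \<in> e} = {}" using that edge by blast
        then show ?thesis by (simp only: degree_def card.empty)
      qed
      then show ?thesis unfolding T_def by (cases "v \<in> V") simp_all
    qed
    have "card (rest v) = card {x. {v, x} \<in> E - K} + of_bool (v \<in> T)"
    proof -
      have "card (rest v) = card (Some ` {x. {v, x} \<in> E - K}) + card (if v \<in> T then {None :: 'a option} else {})"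
        unfolding rest_def using finJ[of v] by (intro card_Un_disjoint) auto
      then show ?thesis by (simp add: card_image)
    qed
    then show ?thesis using par TV by auto
  qed
  have "\<forall>v. \<exists>\<rho>. \<forall>q\<in>rest v. \<rho> q \<in> rest v \<and> \<rho> q \<noteq> q \<and> \<rho> (\<rho> q) = q"
    using even_involution[OF _ even_rest] finJ by (simp add: rest_def)
  then obtain \<rho> where \<rho>: "\<And>v q. q \<in> rest v \<Longrightarrow> \<rho> v q \<in> rest v \<and> \<rho> v q \<noteq> q \<and> \<rho> v (\<rho> v q) = q"
    by metis
  have "even (card T)" unfolding T_def by (rule even_card_odd_degree[OF finV finE edge])
  then have "even (card (Some ` T))" by (simp add: card_image)
  then obtain \<tau> where \<tau>: "\<And>q. q \<in> Some ` T \<Longrightarrow> \<tau> q \<in> Some ` T \<and> \<tau> q \<noteq> q \<and> \<tau> (\<tau> q) = q"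
    using even_involution[of "Some ` T"] finT by blast
  \<comment> \<open>\<open>the q\<close> is only reached for neighbours of the form
    \<open>Some x\<close>: when \<open>None\<close> is a neighbour of \<open>Some v\<close>, it
    belongs to \<open>rest v\<close>.\<close>
  define \<sigma> where "\<sigma> p q = (case p of None \<Rightarrow> \<tau> q | Some v \<Rightarrow> if q \<in> rest v then \<rho> v q else Some (\<pi> v (the q)))" for p q
  have \<sigma>K: "\<sigma> (Some v) (Some x) = Some (\<pi> v x)" if "{v, x} \<in> K" for v x
    using rest_K[OF that] by (simp add: \<sigma>_def)
  have \<sigma>: "(\<sigma> p q, p) \<in> S \<and> \<sigma> p q \<noteq> q \<and> \<sigma> p (\<sigma> p q) = q" if qp: "(q, p) \<in> S" for p q
  proof (cases p)
    case None
    then have "q \<in> Some ` T" using qp by (cases q) (auto simp: NS NN)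
    then show ?thesis using \<tau>[of q] None by (auto simp: \<sigma>_def NS)
  next
    case (Some v)
    then consider "q \<in> rest v" | x where "q = Some x" "{v, x} \<in> K" using restI qp by blast
    then show ?thesis
    proof cases
      case 1
      then show ?thesis using \<rho>[OF 1] rest_S[of "\<rho> v q" v] Some by (simp add: \<sigma>_def)
    next
      case 2
      then have "{v, \<pi> v x} \<in> K" using \<pi> by blast
      then show ?thesis using \<pi>[OF 2(2)] \<sigma>K[OF 2(2)] \<sigma>K[of v "\<pi> v x"] KE 2 Some by (auto simp: SS insert_commute)
    qed
  qed
  have finS: "finite S"
  proof -
    have "{(Some u, Some w) | u w. {u, w} \<in> E} \<subseteq> Some ` V \<times> Some ` V" using edge by auto
    then have "finite {(Some u, Some w) | u w. {u, w} \<in> E}" using finV by (meson finite_SigmaI finite_imageI finite_subset)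
    then show ?thesis using finT by (simp add: S_def)
  qed
  have symS: "(q, p) \<in> S" if "(p, q) \<in> S" for p q
    using that by (cases p; cases q) (auto simp: SS SN NS insert_commute)
  have irrS: "(p, p) \<notin> S" for p
    using edge[of "{the p}"] by (cases p) (auto simp: SS NN)
  have "\<exists>D'. D' \<union> D'\<inverse> = S \<and> D' \<inter> D'\<inverse> = {} \<and> (\<forall>q p. (q, p) \<in> S \<longrightarrow> (q, p) \<in> D' \<longleftrightarrow> (p, \<sigma> p q) \<in> D')"
    by (rule transition_orientation[OF finS symS irrS \<sigma>]) blast+
  then obtain D' where D': "D' \<union> D'\<inverse> = S" "D' \<inter> D'\<inverse> = {}"
    and tr: "\<And>q p. (q, p) \<in> S \<Longrightarrow> (q, p) \<in> D' \<longleftrightarrow> (p, \<sigma> p q) \<in> D'" by blast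
  define D where "D = {(u, w). (Some u, Some w) \<in> D'}"
  show thesis
  proof (rule that[of D])
    show "D \<union> D\<inverse> = {(u, w). {u, w} \<in> E}" using D'(1) SS unfolding D_def by fast
    show "D \<inter> D\<inverse> = {}" using D'(2) unfolding D_def by fast
    show "(x, v) \<in> D \<longleftrightarrow> (v, \<pi> v x) \<in> D" if "{v, x} \<in> K" for v x
      using tr[of "Some x" "Some v"] \<sigma>K[OF that] that KE by (auto simp: D_def SS insert_commute)
    fix v
    let ?N = "{q. (q, Some v) \<in> S}"
    \<comment> \<open>At \<open>Some v\<close> the extended orientation is balanced; dropping the at
      most one arc between \<open>Some v\<close> and \<open>None\<close> changes the difference by
      at most one.\<close>
    have "card {q \<in> ?N. (q, Some v) \<in> D'} = card {q \<in> ?N. (Some v, q) \<in> D'}"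
      by (rule transition_balanced[where \<pi> = "\<sigma> (Some v)"]) (use tr \<sigma> in auto)
    moreover have "{q \<in> ?N. (q, Some v) \<in> D'} = Some ` {u. (u, v) \<in> D} \<union> (if (None, Some v) \<in> D' then {None} else {})" (is "_ = ?A")
    proof -
      have "q \<in> {q \<in> ?N. (q, Some v) \<in> D'} \<longleftrightarrow> q \<in> ?A" for q using D'(1) by (cases q) (auto simp: D_def)
      then show ?thesis by blast
    qed
    moreover have "{q \<in> ?N. (Some v, q) \<in> D'} = Some ` {w. (v, w) \<in> D} \<union> (if (Some v, None) \<in> D' then {None} else {})" (is "_ = ?B")
    proof -
      have "q \<in> {q \<in> ?N. (Some v, q) \<in> D'} \<longleftrightarrow> q \<in> ?B" for q using D'(1) by (cases q) (auto simp: D_def)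
      then show ?thesis by blast
    qed
    moreover have finA: "finite {u. (u, v) \<in> D}" "finite {w. (v, w) \<in> D}"
    proof -
      have "{u. (u, v) \<in> D} \<subseteq> V" "{w. (v, w) \<in> D} \<subseteq> V" using D'(1) SS edge unfolding D_def by blast+
      then show "finite {u. (u, v) \<in> D}" "finite {w. (v, w) \<in> D}" using finV by (auto intro: finite_subset)
    qed
    moreover have "card ?A = card {u. (u, v) \<in> D} + of_bool ((None, Some v) \<in> D')"
      using finA by (subst card_Un_disjoint) (auto simp: card_image)
    moreover have "card ?B = card {w. (v, w) \<in> D} + of_bool ((Some v, None) \<in> D')"
      using finA by (subst card_Un_disjoint) (auto simp: card_image)
    ultimately have "card {u. (u, v) \<in> D} + of_bool ((None, Some v) \<in> D') = card {w. (v, w) \<in> D} + of_bool ((Some v, None) \<in> D')"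
      by simp
    then show "\<bar>int (card {w. (v, w) \<in> D}) - int (card {u. (u, v) \<in> D})\<bar> \<le> 1"
      by (auto simp: of_bool_def split: if_splits)
  qed
qed

lemma nat_diff_le_1: "\<bar>int m - int n\<bar> \<le> 1 \<Longrightarrow> m \<le> n + 1 \<and> n \<le> m + 1"
  by arith

text \<open>Apart from cuts around one vertex, all lower bounds are read off from the arcs on
  \<open>K\<close>, where the orientation is balanced; arcs on the removed tree edges can only
  help.\<close>

theorem smooth_arc_strong_orientation:
  fixes V :: "'a set" and k :: nat
  assumes finV: "finite V" and edge: "\<And>e. e \<in> E \<Longrightarrow> e \<subseteq> V \<and> card e = 2" and V2: "2 \<le> card V" and k: "1 \<le> k"
    and weak: "\<And>A B. A \<inter> B = {} \<Longrightarrow> A \<noteq> {} \<Longrightarrow> A \<union> B \<subset> V \<Longrightarrow>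
      4 * (2 * k + 1) \<le> card {e \<in> E. crosses A e \<and> e \<inter> B = {}} + (2 * k + 1) * card B"
  obtains D where "D \<union> D\<inverse> = {(u, w). {u, w} \<in> E}" "D \<inter> D\<inverse> = {}"
    "\<And>v. \<bar>int (card {w. (v, w) \<in> D}) - int (card {u. (u, v) \<in> D})\<bar> \<le> 1"
    "\<And>X. X \<subset> V \<Longrightarrow> X \<noteq> {} \<Longrightarrow> 2 * k + 1 \<le> card {(u, w). (u, w) \<in> D \<and> u \<notin> X \<and> w \<in> X}"
    "\<And>v X. v \<in> V \<Longrightarrow> X \<subset> V - {v} \<Longrightarrow> X \<noteq> {} \<Longrightarrow>
      k \<le> card {(u, w). (u, w) \<in> D \<and> u \<noteq> v \<and> w \<noteq> v \<and> u \<notin> X \<and> w \<in> X}"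
proof -
  have finE: "finite E" by (rule finite_subset[of _ "Pow V"]) (use edge finV in auto)
  have a3: "3 \<le> 2 * k + 1" and b: "(4 * k + 1) + 1 = 2 * (2 * k + 1)" using k by auto
  have "\<exists>H F. H \<subseteq> E \<and> F \<subseteq> E \<and> H \<inter> F = {} \<and> sparse V (2 * k + 1) (4 * k + 1) H \<and> tight V (2 * k + 1) (4 * k + 1) H V
    \<and> sparse V 1 1 F \<and> tight V 1 1 F V"
    by (rule tight_and_tree_packing[OF finV edge V2 a3 b weak]) blast+
  then obtain H F where HE: "H \<subseteq> E" and FE: "F \<subseteq> E" and HF: "H \<inter> F = {}"
    and spH: "sparse V (2 * k + 1) (4 * k + 1) H" and tH: "tight V (2 * k + 1) (4 * k + 1) H V"
    and spF: "sparse V 1 1 F" and tF: "tight V 1 1 F V" by blast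
  have finH: "finite H" and finF: "finite F" using HE FE finE by (auto intro: finite_subset)
  have edgeH: "e \<subseteq> V \<and> card e = 2" if "e \<in> H" for e using that HE edge by blast
  have edgeF: "e \<subseteq> V \<and> card e = 2" if "e \<in> F" for e using that FE edge by blast
  define T where "T = {x \<in> V. odd (degree E x)}"
  have "even (card T)" unfolding T_def by (rule even_card_odd_degree[OF finV finE edge])
  moreover have "T \<subseteq> V" by (auto simp: T_def)
  ultimately have "\<exists>J\<subseteq>F. \<forall>z. odd (degree J z) \<longleftrightarrow> z \<in> T"
    by (intro T_join[OF finV finF edgeF spanning_tree_crosses[OF finV finF edgeF spF tF]])
  then obtain J where JF: "J \<subseteq> F" and J: "\<And>z. odd (degree J z) \<longleftrightarrow> z \<in> T" by blast
  define K where "K = E - J"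
  have KE: "K \<subseteq> E" and HK: "H \<subseteq> K" using HE HF JF by (auto simp: K_def)
  have finK: "finite K" using KE finE by (rule finite_subset)
  have edgeK: "e \<subseteq> V \<and> card e = 2" if "e \<in> K" for e using that KE edge by blast
  have evenK: "even (degree K x)" for x
  proof -
    have "{e \<in> E. x \<in> e} = {e \<in> K. x \<in> e} \<union> {e \<in> J. x \<in> e}" using JF FE by (auto simp: K_def)
    moreover have "finite J" using JF finF by (rule finite_subset)
    ultimately have deg: "degree E x = degree K x + degree J x"
      unfolding degree_def using finK by (simp add: card_Un_disjoint disjoint_iff K_def)
    show ?thesis
    proof (cases "x \<in> V")
      case True
      then show ?thesis using deg J[of x] by (auto simp: T_def)
    next
      case False
      then have "{e \<in> K. x \<in> e} = {}" using edgeK by blast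
      then show ?thesis by (simp only: degree_def card.empty even_zero)
    qed
  qed
  have connK: "2 * k \<le> card {e \<in> K. v \<notin> e \<and> crosses X e}" if "v \<in> V" "X \<subset> V - {v}" "X \<noteq> {}" for v X
  proof -
    have "4 * k + 1 \<le> card {e \<in> H. v \<notin> e \<and> crosses X e} + (2 * k + 1)"
      by (rule tight_vertex_deleted_cut[OF finV finH edgeH spH tH that])
    moreover have "card {e \<in> H. v \<notin> e \<and> crosses X e} \<le> card {e \<in> K. v \<notin> e \<and> crosses X e}"
      using HK finK by (intro card_mono) auto
    ultimately show ?thesis by linarith
  qed
  define pairs where "pairs v \<pi> \<longleftrightarrow> (\<forall>x. {v, x} \<in> K \<longrightarrow> \<pi> x \<noteq> x \<and> {v, \<pi> x} \<in> K \<and> \<pi> (\<pi> x) = x)" for v \<pi>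
  define cut where "cut v \<pi> \<longleftrightarrow> (\<forall>X. X \<subset> V - {v} \<longrightarrow> X \<noteq> {} \<longrightarrow>
      card {x \<in> X. {v, x} \<in> K \<and> \<pi> x \<notin> X} + 2 * k \<le> card {e \<in> K. v \<notin> e \<and> crosses X e})" for v \<pi>
  have "\<exists>\<pi>. pairs v \<pi> \<and> (v \<in> V \<longrightarrow> cut v \<pi>)" for v
  proof (cases "v \<in> V")
    case True
    have "\<exists>\<pi>. pairs v \<pi> \<and> cut v \<pi>"
      unfolding pairs_def cut_def by (rule transitions_at_vertex[OF finV finK edgeK evenK connK[OF True]])
    then show ?thesis by blast
  next
    case False
    then have "{v, x} \<notin> K" for x using edgeK by blast
    then show ?thesis using False by (simp add: pairs_def)
  qed
  then obtain \<pi> where \<pi>0: "pairs v (\<pi> v)" "v \<in> V \<Longrightarrow> cut v (\<pi> v)" for v by metis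
  have \<pi>: "\<pi> v x \<noteq> x \<and> {v, \<pi> v x} \<in> K \<and> \<pi> v (\<pi> v x) = x" if "{v, x} \<in> K" for v x
    using \<pi>0(1)[of v] that by (simp add: pairs_def)
  have \<pi>cut: "card {x \<in> X. {v, x} \<in> K \<and> \<pi> v x \<notin> X} + 2 * k \<le> card {e \<in> K. v \<notin> e \<and> crosses X e}"
    if "v \<in> V" "X \<subset> V - {v}" "X \<noteq> {}" for v X
    using \<pi>0(2)[OF that(1)] that(2,3) by (simp add: cut_def)
  have "\<exists>D. D \<union> D\<inverse> = {(u, w). {u, w} \<in> E} \<and> D \<inter> D\<inverse> = {}
    \<and> (\<forall>v. \<bar>int (card {w. (v, w) \<in> D}) - int (card {u. (u, v) \<in> D})\<bar> \<le> 1)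
    \<and> (\<forall>v x. {v, x} \<in> K \<longrightarrow> (x, v) \<in> D \<longleftrightarrow> (v, \<pi> v x) \<in> D)"
    by (rule smooth_transition_orientation[OF finV edge KE evenK \<pi>]) blast+
  then obtain D where D: "D \<union> D\<inverse> = {(u, w). {u, w} \<in> E}" "D \<inter> D\<inverse> = {}"
    and smooth: "\<And>v. \<bar>int (card {w. (v, w) \<in> D}) - int (card {u. (u, v) \<in> D})\<bar> \<le> 1"
    and tr: "\<And>v x. {v, x} \<in> K \<Longrightarrow> (x, v) \<in> D \<longleftrightarrow> (v, \<pi> v x) \<in> D" by blast
  have DE: "{u, w} \<in> E" if "(u, w) \<in> D" for u w using that D(1) by blast
  have DV: "u \<in> V \<and> w \<in> V \<and> u \<noteq> w" if "(u, w) \<in> D" for u w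
    using edge[OF DE[OF that]] by (auto split: if_splits)
  have finD: "finite D" by (rule finite_subset[of _ "V \<times> V"]) (use DV finV in auto)
  define DK where "DK = {(u, w). (u, w) \<in> D \<and> {u, w} \<in> K}"
  have DKD: "DK \<subseteq> D" by (auto simp: DK_def)
  have finDK: "finite DK" using DKD finD by (rule finite_subset)
  have "(u, w) \<in> DK \<or> (w, u) \<in> DK \<longleftrightarrow> {u, w} \<in> K" for u w
  proof -
    have "(u, w) \<in> D \<or> (w, u) \<in> D" if "{u, w} \<in> K" using that KE D(1) by blast
    then show ?thesis unfolding DK_def by (auto simp: insert_commute)
  qed
  then have DK: "DK \<union> DK\<inverse> = {(u, w). {u, w} \<in> K}" by blast
  have DK': "DK \<inter> DK\<inverse> = {}" using D(2) DKD by blast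
  have edgeK2: "card e = 2" if "e \<in> K" for e using edgeK[OF that] by simp
  \<comment> \<open>The transitions never leave \<open>K\<close>, so they match the arcs of
    \<open>DK\<close> entering \<open>v\<close> with those leaving it.\<close>
  have bal: "card {u. (u, v) \<in> DK} = card {w. (v, w) \<in> DK}" for v
  proof -
    have "card {u \<in> {x. {v, x} \<in> K}. (u, v) \<in> D} = card {u \<in> {x. {v, x} \<in> K}. (v, u) \<in> D}"
      by (rule transition_balanced[where \<pi> = "\<pi> v"]) (use tr \<pi> in auto)
    then show ?thesis by (simp add: DK_def insert_commute conj_commute)
  qed
  have trK: "(x, v) \<in> DK \<longleftrightarrow> (v, \<pi> v x) \<in> DK" if "{v, x} \<in> K" for v x
    using tr[OF that] \<pi>[OF that] that by (simp add: DK_def insert_commute)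
  have in_mono: "card {(u, w). (u, w) \<in> DK \<and> Q u w} \<le> card {(u, w). (u, w) \<in> D \<and> Q u w}" for Q
  proof (rule card_mono)
    show "finite {(u, w). (u, w) \<in> D \<and> Q u w}" by (rule finite_subset[OF _ finD]) auto
    show "{(u, w). (u, w) \<in> DK \<and> Q u w} \<subseteq> {(u, w). (u, w) \<in> D \<and> Q u w}" using DKD by auto
  qed
  have cut_sum: "card {e \<in> L. crosses X e} = card {(u, w). (u, w) \<in> A \<and> u \<notin> X \<and> w \<in> X}
      + card {(u, w). (u, w) \<in> A \<and> u \<in> X \<and> w \<notin> X}"
    if A: "finite A" "A \<union> A\<inverse> = {(u, w). {u, w} \<in> L}" "A \<inter> A\<inverse> = {}" "\<And>e. e \<in> L \<Longrightarrow> card e = 2" for L A X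
  proof -
    let ?i = "{(u, w). (u, w) \<in> A \<and> u \<notin> X \<and> w \<in> X}" and ?o = "{(u, w). (u, w) \<in> A \<and> u \<in> X \<and> w \<notin> X}"
    have "finite ?i" "finite ?o" by (rule finite_subset[OF _ A(1)]; auto)+
    then have "card (?i \<union> ?o) = card ?i + card ?o" by (intro card_Un_disjoint) auto
    moreover have "{(u, w). (u, w) \<in> A \<and> crosses X {u, w}} = ?i \<union> ?o" by auto
    ultimately show ?thesis using card_arcs_eq_card_edges[OF A(2,3,4), of "crosses X"] by simp
  qed
  have "{(u, w). (u, w) \<in> D \<and> u \<notin> {v} \<and> w \<in> {v}} = (\<lambda>u. (u, v)) ` {u. (u, v) \<in> D}" for v using DV by auto
  then have in1: "card {(u, w). (u, w) \<in> D \<and> u \<notin> {v} \<and> w \<in> {v}} = card {u. (u, v) \<in> D}" for v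
    by (simp add: card_image inj_on_def)
  have "{(u, w). (u, w) \<in> D \<and> u \<in> {v} \<and> w \<notin> {v}} = Pair v ` {w. (v, w) \<in> D}" for v using DV by auto
  then have out1: "card {(u, w). (u, w) \<in> D \<and> u \<in> {v} \<and> w \<notin> {v}} = card {w. (v, w) \<in> D}" for v
    by (simp add: card_image inj_on_def)
  have deg: "2 * k + 1 \<le> card {u. (u, v) \<in> D}" "2 * k + 1 \<le> card {w. (v, w) \<in> D}" if v: "v \<in> V" for v
  proof -
    have "{v} \<noteq> V" using V2 by auto
    then have "{v} \<subset> V" using v by blast
    then have "4 * (2 * k + 1) \<le> card {e \<in> E. crosses {v} e}" using weak[of "{v}" "{}"] by simp
    moreover have "card {e \<in> E. crosses {v} e} = card {u. (u, v) \<in> D} + card {w. (v, w) \<in> D}"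
      using cut_sum[OF finD D, of "{v}"] edge unfolding in1 out1 by blast
    ultimately have "4 * (2 * k + 1) \<le> card {u. (u, v) \<in> D} + card {w. (v, w) \<in> D}" by simp
    then show "2 * k + 1 \<le> card {u. (u, v) \<in> D}" "2 * k + 1 \<le> card {w. (v, w) \<in> D}"
      using nat_diff_le_1[OF smooth[of v]] by auto
  qed
  show thesis
  proof (rule that[OF D smooth])
    fix X assume X: "X \<subset> V" "X \<noteq> {}"
    have finX: "finite X" using X finV by (meson finite_subset psubset_imp_subset)
    \<comment> \<open>\<open>tight_cut\<close> needs two vertices on both sides; a single vertex on
      either side is handled by its in-degree or out-degree.\<close>
    consider v where "X = {v}" | v where "V - X = {v}" | "2 \<le> card X" "2 \<le> card (V - X)"
    proof -
      have "card X \<noteq> 0" using X finX by simp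
      moreover have "card (V - X) \<noteq> 0" using X finV by auto
      ultimately consider "card X = 1" | "card (V - X) = 1" | "2 \<le> card X" "2 \<le> card (V - X)" by linarith
      then show thesis using that by cases (auto simp: card_1_singleton_iff)
    qed
    then show "2 * k + 1 \<le> card {(u, w). (u, w) \<in> D \<and> u \<notin> X \<and> w \<in> X}"
    proof cases
      case (1 v)
      then have "v \<in> V" using X by blast
      then show ?thesis using deg(1)[of v] in1[of v] 1 by simp
    next
      case (2 v)
      then have "{(u, w). (u, w) \<in> D \<and> u \<notin> X \<and> w \<in> X} = {(u, w). (u, w) \<in> D \<and> u \<in> {v} \<and> w \<notin> {v}}"
        using DV X by blast
      moreover have "v \<in> V" using 2 by blast
      ultimately show ?thesis using deg(2)[of v] out1[of v] by simp
    next
      case 3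
      have "4 * k + 1 \<le> card {e \<in> H. crosses X e}"
        using X by (intro tight_cut[OF finV finH spH tH _ 3]) auto
      also have "\<dots> \<le> card {e \<in> K. crosses X e}" using HK finK by (intro card_mono) auto
      \<comment> \<open>Balance makes the cut even, and this closes the gap of one:
        \<open>4 * k + 1\<close> edges already force \<open>2 * k + 1\<close> entering arcs.\<close>
      also have "\<dots> = 2 * card {(u, w). (u, w) \<in> DK \<and> u \<notin> X \<and> w \<in> X}"
        using cut_sum[OF finDK DK DK' edgeK2, of X] balanced_cut[OF finDK finX bal] by simp
      finally have "2 * k + 1 \<le> card {(u, w). (u, w) \<in> DK \<and> u \<notin> X \<and> w \<in> X}" by linarith
      then show ?thesis using in_mono[of "\<lambda>u w. u \<notin> X \<and> w \<in> X"] by linarith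
    qed
  next
    fix v X assume v: "v \<in> V" and X: "X \<subset> V - {v}" "X \<noteq> {}"
    have finX: "finite X" using X finV by (meson finite_Diff finite_subset psubset_imp_subset)
    have "k \<le> card {(u, w). (u, w) \<in> DK \<and> u \<noteq> v \<and> w \<noteq> v \<and> u \<notin> X \<and> w \<in> X}"
      by (rule vertex_deleted_in_degree[OF finDK DK DK' edgeK2 finX _ bal _ trK \<pi>cut[OF v X]])
        (use X \<pi> in auto)
    then show "k \<le> card {(u, w). (u, w) \<in> D \<and> u \<noteq> v \<and> w \<noteq> v \<and> u \<notin> X \<and> w \<in> X}"
      using in_mono[of "\<lambda>u w. u \<noteq> v \<and> w \<noteq> v \<and> u \<notin> X \<and> w \<in> X"] by linarith
  qed
qed

section \<open>Transfer to library graphs\<close>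

theorem theorem10p6:
  fixes k :: nat and G :: "'a pair_pre_digraph"
  assumes "k \<ge> 1"
    and "pair_graph G"
    and "weakly_connected (2 * k + 1) (8 * k + 4) (with_proj G)"
  shows "\<exists>D. orientation_of D G \<and> smooth (with_proj D) \<and>
    arc_strong (2 * k + 1) (with_proj D) \<and>
    (\<forall>v \<in> pverts D. arc_strong k (pre_digraph.del_vert (with_proj D) v))"
proof -
  interpret pair_graph G by (fact assms(2))
  define V where "V = pverts G"
  define E where "E = (\<lambda>(u, w). {u, w}) ` parcs G"
  have finV: "finite V" by (simp add: V_def)
  have arcV: "u \<in> V \<and> w \<in> V \<and> u \<noteq> w" if "(u, w) \<in> parcs G" for u w
    using that arc_fst_in_verts[OF that] arc_snd_in_verts[OF that] pair_no_loops[OF that] by (simp add: V_def)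
  have symG: "(w, u) \<in> parcs G" if "(u, w) \<in> parcs G" for u w
    using that pair_sym_arcs by (auto simp: symmetric_def sym_def)
  have edge: "e \<subseteq> V \<and> card e = 2" if e: "e \<in> E" for e
  proof -
    obtain u w where "(u, w) \<in> parcs G" "e = {u, w}" using e by (auto simp: E_def)
    then show ?thesis using arcV[of u w] by simp
  qed
  have E_iff: "{u, w} \<in> E \<longleftrightarrow> (u, w) \<in> parcs G" for u w
    using symG by (auto simp: E_def doubleton_eq_iff image_iff)
  show ?thesis
  proof (cases "2 \<le> card V")
    case False
    \<comment> \<open>With at most one vertex there are no arcs and no nonempty proper vertex sets,
      so \<open>G\<close> is its own orientation.\<close>
    have one: "x = y" if "x \<in> V" "y \<in> V" for x y
    proof (rule ccontr)
      assume "x \<noteq> y"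
      moreover have "card {x, y} \<le> card V" using that finV by (intro card_mono) auto
      ultimately show False using False by simp
    qed
    have noX: "X = {}" if "X \<subset> V" for X
      using that one by blast
    have "(u, w) \<notin> parcs G" for u w using arcV[of u w] one[of u w] by blast
    then have "parcs G = {}" by auto
    then have "orientation_of G G" by (simp add: orientation_of_def)
    moreover have "smooth (with_proj G)"
      using \<open>parcs G = {}\<close> by (simp add: smooth_def in_degree_def out_degree_def in_arcs_def out_arcs_def)
    moreover have "arc_strong (2 * k + 1) (with_proj G)"
      using noX by (auto simp: arc_strong_def V_def)
    moreover have "arc_strong k (pre_digraph.del_vert (with_proj G) v)" for v
      unfolding arc_strong_def pre_digraph.del_vert_def using noX by (auto simp: V_def)
    ultimately show ?thesis by blast
  next
    case V2: True
    have weak: "4 * (2 * k + 1) \<le> card {e \<in> E. crosses A e \<and> e \<inter> B = {}} + (2 * k + 1) * card B"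
      if AB: "A \<inter> B = {}" "A \<noteq> {}" "A \<union> B \<subset> V" for A B
    proof -
      have "uedges (with_proj G \<restriction> (V - B)) = {e \<in> E. e \<inter> B = {}}"
      proof (intro equalityI subsetI)
        fix e assume "e \<in> uedges (with_proj G \<restriction> (V - B))"
        then show "e \<in> {e \<in> E. e \<inter> B = {}}" by (auto simp: uedges_def E_def)
      next
        fix e assume "e \<in> {e \<in> E. e \<inter> B = {}}"
        then obtain u w where e: "(u, w) \<in> parcs G" "e = {u, w}" "e \<inter> B = {}" by (auto simp: E_def)
        then have "(u, w) \<in> arcs (with_proj G \<restriction> (V - B))" using arcV[of u w] by auto
        then show "e \<in> uedges (with_proj G \<restriction> (V - B))" using e(2) unfolding uedges_def by force
      qed
      \<comment> \<open>This needs two distinct ends: a loop inside \<open>A\<close> would meet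
        \<open>A\<close> in one vertex without crossing it.\<close>
      moreover have "card (e \<inter> A) = 1 \<longleftrightarrow> crosses A e" if e: "e \<in> E" for e
      proof -
        obtain x y where "e = {x, y}" "x \<noteq> y" using edge[OF e] by (auto simp: card_2_iff)
        then show ?thesis by (cases "x \<in> A"; cases "y \<in> A") auto
      qed
      ultimately have "cut_degree (with_proj G \<restriction> (V - B)) A = card {e \<in> E. crosses A e \<and> e \<inter> B = {}}"
        unfolding cut_degree_def by (intro arg_cong[where f = card]) auto
      moreover have "int (8 * k + 4) - int (2 * k + 1) * int (card B) \<le> int (cut_degree (with_proj G \<restriction> (V - B)) A)"
        using assms(3) AB unfolding weakly_connected_def V_def by simp
      ultimately have "int (8 * k + 4) \<le> int (card {e \<in> E. crosses A e \<and> e \<inter> B = {}} + (2 * k + 1) * card B)"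
        by (simp add: algebra_simps)
      then have "8 * k + 4 \<le> card {e \<in> E. crosses A e \<and> e \<inter> B = {}} + (2 * k + 1) * card B"
        by (simp only: of_nat_le_iff)
      then show ?thesis by simp
    qed
    have "\<exists>A. A \<union> A\<inverse> = {(u, w). {u, w} \<in> E} \<and> A \<inter> A\<inverse> = {}
      \<and> (\<forall>v. \<bar>int (card {w. (v, w) \<in> A}) - int (card {u. (u, v) \<in> A})\<bar> \<le> 1)
      \<and> (\<forall>X. X \<subset> V \<longrightarrow> X \<noteq> {} \<longrightarrow> 2 * k + 1 \<le> card {(u, w). (u, w) \<in> A \<and> u \<notin> X \<and> w \<in> X})
      \<and> (\<forall>v X. v \<in> V \<longrightarrow> X \<subset> V - {v} \<longrightarrow> X \<noteq> {} \<longrightarrow>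
        k \<le> card {(u, w). (u, w) \<in> A \<and> u \<noteq> v \<and> w \<noteq> v \<and> u \<notin> X \<and> w \<in> X})"
      by (rule smooth_arc_strong_orientation[OF finV edge V2 assms(1) weak]) blast+
    then obtain A where A: "A \<union> A\<inverse> = {(u, w). {u, w} \<in> E}" "A \<inter> A\<inverse> = {}"
      and sm: "\<forall>v. \<bar>int (card {w. (v, w) \<in> A}) - int (card {u. (u, v) \<in> A})\<bar> \<le> 1"
      and st: "\<forall>X. X \<subset> V \<longrightarrow> X \<noteq> {} \<longrightarrow> 2 * k + 1 \<le> card {(u, w). (u, w) \<in> A \<and> u \<notin> X \<and> w \<in> X}"
      and stv: "\<forall>v X. v \<in> V \<longrightarrow> X \<subset> V - {v} \<longrightarrow> X \<noteq> {} \<longrightarrow>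
        k \<le> card {(u, w). (u, w) \<in> A \<and> u \<noteq> v \<and> w \<noteq> v \<and> u \<notin> X \<and> w \<in> X}"
      by (elim exE conjE) (rule that; assumption)
    define D where "D = \<lparr>pverts = V, parcs = A\<rparr>"
    have "orientation_of D G"
      using A by (auto simp: orientation_of_def D_def V_def E_iff)
    moreover have "smooth (with_proj D)"
    proof -
      have "out_arcs (with_proj D) v = Pair v ` {w. (v, w) \<in> A}" for v
        by (auto simp: out_arcs_def D_def)
      then have "out_degree (with_proj D) v = card {w. (v, w) \<in> A}" for v
        by (simp add: out_degree_def card_image inj_on_def)
      moreover have "in_arcs (with_proj D) v = (\<lambda>u. (u, v)) ` {u. (u, v) \<in> A}" for v
        by (auto simp: in_arcs_def D_def)
      then have "in_degree (with_proj D) v = card {u. (u, v) \<in> A}" for v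
        by (simp add: in_degree_def card_image inj_on_def)
      ultimately show ?thesis using sm by (simp add: smooth_def)
    qed
    moreover have "arc_strong (2 * k + 1) (with_proj D)"
    proof -
      have "set_in_degree (with_proj D) X = card {(u, w). (u, w) \<in> A \<and> u \<notin> X \<and> w \<in> X}" for X
        unfolding set_in_degree_def by (intro arg_cong[where f = card]) (auto simp: D_def)
      then show ?thesis using st by (simp add: arc_strong_def D_def)
    qed
    moreover have "arc_strong k (pre_digraph.del_vert (with_proj D) v)" if "v \<in> pverts D" for v
    proof -
      have "set_in_degree (pre_digraph.del_vert (with_proj D) v) X
          = card {(u, w). (u, w) \<in> A \<and> u \<noteq> v \<and> w \<noteq> v \<and> u \<notin> X \<and> w \<in> X}" for X
        unfolding set_in_degree_def pre_digraph.del_vert_def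
        by (intro arg_cong[where f = card]) (auto simp: D_def)
      moreover have "verts (pre_digraph.del_vert (with_proj D) v) = V - {v}"
        by (simp add: pre_digraph.del_vert_def D_def)
      moreover have "v \<in> V" using that by (simp add: D_def)
      ultimately show ?thesis using stv by (simp add: arc_strong_def)
    qed
    ultimately show ?thesis by blast
  qed
qed

end
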